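(* Let $\ell_0>0$ and $(y_0,y_1)\in C^1([0,\ell_0])\times C^0([0,\ell_0])$ satisfy $$y_0(\ell_0)=0,\qquad y_1(\ell_0)=-\max\left[\frac{\frac12(y_1(\ell_0)-y_0'(\ell_0))^2-\kappa(\ell_0)}{\frac12(y_1(\ell_0)-y_0'(\ell_0))^2+\kappa(\ell_0)},\,0\right]y_0'(\ell_0).$$ Let $T>\ell_0$, and let $(\bar\ell_0,\bar y_0,\bar y_1)$ be a $C^1$-admissible final data set. Suppose there exist $0<\bar t_\ast<T$ and a $C^1$-admissible final branch $\mathscr L\in C^1([\bar t_\ast,T])$ (for $T$ and $(\bar\ell_0,\bar y_0,\bar y_1)$) such that, with $\bar\ell_\ast:=\mathscr L(\bar t_\ast)$, $\bar\ell_\ast':=\mathscr L'(\bar t_\ast)$, and with $\ell_\ast,\ell_\ast'$ the size and speed at the end of the initial branch determined by $(\ell_0,y_0,y_1)$: - $\ell_\ast\le\bar\ell_\ast$ if $\ell_\ast'=\bar\ell_\ast'=0$, and $\ell_\ast<\bar\ell_\ast$ otherwise; - $\bar\ell_\ast<\bar t_\ast$. Then there is a control $u\in C^1([0,T])$ such that the $C^1$-solution $(\ell,y)$ on $[0,T]$ of the debonding system with data $(\ell_0,y_0,y_1)$ and control $u$ satisfies $$\ell(T)=\bar\ell_0,\qquad y(T,\cdot)=\bar y_0,\qquad \partial_t y(T,\cdot)=\bar y_1 .$$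
   Context: Fix $0<c_1<c_2$ and a locally Lipschitz function $\kappa:[0,\infty)\to[c_1,c_2]$. Debonding system. Given $\ell_0>0$, $(y_0,y_1)$ on $[0,\ell_0]$ and a control $u$ on $[0,T]$, the unknowns are the front $\ell:[0,T]\to(0,\infty)$ and the displacement $y$ on $\{0\le t\le T,\ 0\le x\le \ell(t)\}$. The equations are $\partial_{tt}^2y-\partial_{xx}^2y=0$ for $0<x<\ell(t)$; $y(t,0)=u(t)$; $y(t,\ell(t))=0$; $y(0,\cdot)=y_0$; $\partial_ty(0,\cdot)=y_1$; together with Griffith's criterion $\ell'\ge0$, $G_{\ell'(t)}(t)\le\kappa(\ell(t))$, $\ell'(t)[G_{\ell'(t)}(t)-\kappa(\ell(t))]=0$, $\ell(0)=\ell_0$, where $G_{\ell'(t)}(t)=\frac12(1-\ell'(t)^2)(\partial_xy(t,\ell(t)))^2$. Solutions are understood through the following equivalent formulation. Put $\tau_\pm(t)=t\pm\ell(t)$ (strictly increasing). There is $f:[-\ell_0,T]\to\mathbb R$ with (1) $f(s)=\frac12\int_0^{-s}(y_0'-y_1)(\sigma)\,d\sigma$ for $s\in[-\ell_0,0]$; $f(s)=u(s)-u(0)-\frac12\int_0^s(y_0'+y_1)(\sigma)\,d\sigma$ for $s\in(0,\ell_0]$, $s\le T$; $f(s)=u(s)+f(\tau_-(\tau_+^{-1}(s)))$ for $s\in(\ell_0,T]$; (2) $\ell(0)=\ell_0$ and $\ell'(t)=\max\Big[\frac{2f'(t-\ell(t))^2-\kappa(\ell(t))}{2f'(t-\ell(t))^2+\kappa(\ell(t))},0\Big]$;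 (3) $y(t,x)=f(t-x)-g(t+x)$, where $g(s)=-u(0)-\frac12\int_0^s(y_0'+y_1)(\sigma)\,d\sigma$ for $0\le s\le\ell_0$ and $g(s)=f(\tau_-(\tau_+^{-1}(s)))$ for $\ell_0<s\le T+\ell(T)$ (i.e. $y(t,x)=u(t+x)-f(t+x)+f(t-x)$). A $C^1$-solution on $[0,T]$ is one with $\ell\in C^1([0,T])$, $y\in C^1(\{0\le t\le T,0\le x\le\ell(t)\})$, $f\in C^1([-\ell_0,T])$; all identities then hold pointwise. Derivatives in $t$ at $t=T$ are one-sided. Initial branch. Until the time $t_\ast$ at which $t-\ell(t)=0$, $\ell$ depends only on $(\ell_0,y_0,y_1)$: it solves $\ell(0)=\ell_0$, $\ell'(t)=\max\Big[\frac{\frac12 w^2-\kappa(\ell(t))}{\frac12 w^2+\kappa(\ell(t))},0\Big]$ with $w=(y_1-y_0')(\ell(t)-t)$. Define $t_\ast$ as the time with $\ell(t_\ast)=t_\ast$, and $\ell_\ast:=\ell(t_\ast)=t_\ast$, $\ell_\ast':=\ell'(t_\ast)$. $C^1$-admissible final data set: a triple $(\bar\ell_0,\bar y_0,\bar y_1)$ with $\bar\ell_0\ge\ell_0$, $(\bar y_0,\bar y_1)\in C^1([0,\bar\ell_0])\times C^0([0,\bar\ell_0])$, $\bar y_0(\bar\ell_0)=0$ and $\bar y_1(\bar\ell_0)=-\alpha\,\bar y_0'(\bar\ell_0)$ for some $\alpha\in\Big\{0,\sqrt{1-\tfrac{2\kappa(\bar\ell_0)}{|\bar y_0'(\bar\ell_0)|^2}}\Big\}\cap[0,1)$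 (the second element being present only when it is a well-defined real number). $C^1$-admissible final branch (for $T>\ell_0$, $0<\bar t_\ast<T$, and such a triple): a function $\mathscr L\in C^1([\bar t_\ast,T])$ such that, writing $Y(t)=|(\bar y_1+\bar y_0')(t+\mathscr L(t)-T)|^2$, for every $t\in[\bar t_\ast,T]$ one has $Y(t)\le2\kappa(\mathscr L(t))$ and $\mathscr L'(t)\in\Big\{0,\frac{2\kappa(\mathscr L(t))-Y(t)}{2\kappa(\mathscr L(t))+Y(t)}\Big\}\cap[0,1)$, and moreover $\mathscr L(T)=\bar\ell_0$, $\bar t_\ast+\mathscr L(\bar t_\ast)=T$, and $\mathscr L'(T)=\alpha$ with $\alpha$ as in the definition of the final data set. *)

theory Defs
  imports "HOL-Analysis.Analysis"
begin

text \<open>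
  Functions given on an interval or a region are total functions of which only the values on that
  set are constrained or used. All derivatives are taken relative to the set, so they are one-sided
  at end points and boundary points.
\<close>

definition C1_on :: "'a::real_normed_vector set \<Rightarrow> ('a \<Rightarrow> real) \<Rightarrow> bool" where
  "C1_on S f \<longleftrightarrow>
     (\<exists>f'. (\<forall>p\<in>S. (f has_derivative f' p) (at p within S)) \<and>
           (\<forall>v. continuous_on S (\<lambda>p. f' p v)))"

definition deriv_on :: "real set \<Rightarrow> (real \<Rightarrow> real) \<Rightarrow> real \<Rightarrow> real" where
  "deriv_on S f s = vector_derivative f (at s within S)"

text \<open>
  The time derivative at \<open>(t, x)\<close> is the \<open>(1, 0)\<close>-component of the derivative relative to \<open>S\<close>.
  Differentiating along the slice \<open>{t. (t, x) \<in> S}\<close> would not do: when the front arrives at time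
  \<open>T\<close> with positive speed, the slice through \<open>x = l T\<close> is the single point \<open>t = T\<close>.
\<close>

definition partial_t :: "(real \<times> real) set \<Rightarrow> (real \<Rightarrow> real \<Rightarrow> real) \<Rightarrow> real \<Rightarrow> real \<Rightarrow> real" where
  "partial_t S y t x = frechet_derivative (case_prod y) (at (t, x) within S) (1, 0)"

text \<open>Toughness: locally Lipschitz from the half-line \<open>{0..}\<close> to \<open>{c1..c2}\<close>. The first argument
  of \<^const>\<open>local_lipschitz\<close> is a time variable, on which the toughness does not depend.\<close>

definition toughness :: "real \<Rightarrow> real \<Rightarrow> (real \<Rightarrow> real) \<Rightarrow> bool" where
  "toughness c1 c2 \<kappa> \<longleftrightarrow>
     0 < c1 \<and> c1 < c2 \<and> (\<forall>x\<ge>0. \<kappa> x \<in> {c1..c2}) \<and>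
     local_lipschitz (UNIV :: real set) {0..} (\<lambda>_. \<kappa>)"

text \<open>Speed selected by Griffith's criterion; \<open>q\<close> is \<open>2 * f'\<^sup>2\<close> for the outgoing wave \<open>f\<close>.\<close>

definition front_speed :: "real \<Rightarrow> real \<Rightarrow> real" where
  "front_speed q k = max ((q - k) / (q + k)) 0"

definition region :: "real \<Rightarrow> (real \<Rightarrow> real) \<Rightarrow> (real \<times> real) set" where
  "region T l = {(t, x). 0 \<le> t \<and> t \<le> T \<and> 0 \<le> x \<and> x \<le> l t}"

text \<open>\<open>reflect T l\<close> is the map sending \<open>t + l t\<close> to \<open>t - l t\<close> for \<open>t \<in> {0..T}\<close>.\<close>

definition reflect :: "real \<Rightarrow> (real \<Rightarrow> real) \<Rightarrow> real \<Rightarrow> real" where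
  "reflect T l s = (let t = the_inv_into {0..T} (\<lambda>t. t + l t) s in t - l t)"

definition outgoing_wave ::
  "real \<Rightarrow> (real \<Rightarrow> real) \<Rightarrow> (real \<Rightarrow> real) \<Rightarrow> real \<Rightarrow> (real \<Rightarrow> real) \<Rightarrow> (real \<Rightarrow> real) \<Rightarrow> (real \<Rightarrow> real) \<Rightarrow> bool"
where
  "outgoing_wave l0 y0 y1 T u l f \<longleftrightarrow>
     (\<forall>s\<in>{- l0..0}. f s = 1/2 * integral {0..- s} (\<lambda>\<sigma>. deriv_on {0..l0} y0 \<sigma> - y1 \<sigma>)) \<and>
     (\<forall>s\<in>{0<..l0}. s \<le> T \<longrightarrow>
        f s = u s - u 0 - 1/2 * integral {0..s} (\<lambda>\<sigma>. deriv_on {0..l0} y0 \<sigma> + y1 \<sigma>)) \<and>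
     (\<forall>s\<in>{l0<..T}. f s = u s + f (reflect T l s))"

definition incoming_wave ::
  "real \<Rightarrow> (real \<Rightarrow> real) \<Rightarrow> (real \<Rightarrow> real) \<Rightarrow> real \<Rightarrow> (real \<Rightarrow> real) \<Rightarrow> (real \<Rightarrow> real) \<Rightarrow> (real \<Rightarrow> real) \<Rightarrow> real \<Rightarrow> real"
where
  "incoming_wave l0 y0 y1 T u l f s =
     (if s \<le> l0 then - u 0 - 1/2 * integral {0..s} (\<lambda>\<sigma>. deriv_on {0..l0} y0 \<sigma> + y1 \<sigma>)
      else f (reflect T l s))"

definition C1_solution ::
  "(real \<Rightarrow> real) \<Rightarrow> real \<Rightarrow> (real \<Rightarrow> real) \<Rightarrow> (real \<Rightarrow> real) \<Rightarrow> real \<Rightarrow> (real \<Rightarrow> real) \<Rightarrow>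
   (real \<Rightarrow> real) \<Rightarrow> (real \<Rightarrow> real \<Rightarrow> real) \<Rightarrow> bool"
where
  "C1_solution \<kappa> l0 y0 y1 T u l y \<longleftrightarrow>
     (\<forall>t\<in>{0..T}. 0 < l t) \<and> C1_on {0..T} l \<and> C1_on (region T l) (case_prod y) \<and>
     (\<exists>f. C1_on {- l0..T} f \<and>
          outgoing_wave l0 y0 y1 T u l f \<and>
          l 0 = l0 \<and>
          (\<forall>t\<in>{0..T}. deriv_on {0..T} l t =
             front_speed (2 * (deriv_on {- l0..T} f (t - l t))\<^sup>2) (\<kappa> (l t))) \<and>
          (\<forall>(t, x)\<in>region T l. y t x = f (t - x) - incoming_wave l0 y0 y1 T u l f (t + x)))"

text \<open>\<open>l\<close> is the initial branch of the front and \<open>ts\<close> the time at which \<open>t - l t\<close> vanishes.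
  Since \<open>front_speed\<close> takes values in \<open>{0..<1}\<close>, \<open>l t - t\<close> decreases from \<open>l0\<close> to \<open>0\<close>.\<close>

definition initial_branch ::
  "(real \<Rightarrow> real) \<Rightarrow> real \<Rightarrow> (real \<Rightarrow> real) \<Rightarrow> (real \<Rightarrow> real) \<Rightarrow> real \<Rightarrow> (real \<Rightarrow> real) \<Rightarrow> bool"
where
  "initial_branch \<kappa> l0 y0 y1 ts l \<longleftrightarrow>
     0 < ts \<and> C1_on {0..ts} l \<and> l 0 = l0 \<and> l ts = ts \<and>
     (\<forall>t\<in>{0..ts}. deriv_on {0..ts} l t =
        front_speed (1/2 * (y1 (l t - t) - deriv_on {0..l0} y0 (l t - t))\<^sup>2) (\<kappa> (l t)))"

text \<open>The final speed \<open>\<alpha>\<close> is a parameter because the final branch refers to it. It is determined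
  by the triple: \<open>\<alpha> = 0\<close> if \<open>yb0\<close> has zero slope at \<open>lb0\<close>, and otherwise the slope determines it
  through the condition on \<open>yb1 lb0\<close>.\<close>

definition final_data ::
  "(real \<Rightarrow> real) \<Rightarrow> real \<Rightarrow> real \<Rightarrow> (real \<Rightarrow> real) \<Rightarrow> (real \<Rightarrow> real) \<Rightarrow> real \<Rightarrow> bool"
where
  "final_data \<kappa> l0 lb0 yb0 yb1 \<alpha> \<longleftrightarrow>
     (let p = deriv_on {0..lb0} yb0 lb0 in
        l0 \<le> lb0 \<and> C1_on {0..lb0} yb0 \<and> continuous_on {0..lb0} yb1 \<and>
        yb0 lb0 = 0 \<and> yb1 lb0 = - \<alpha> * p \<and> \<alpha> \<in> {0..<1} \<and>
        (\<alpha> = 0 \<or>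
         p \<noteq> 0 \<and> 0 \<le> 1 - 2 * \<kappa> lb0 / \<bar>p\<bar>\<^sup>2 \<and> \<alpha> = sqrt (1 - 2 * \<kappa> lb0 / \<bar>p\<bar>\<^sup>2)))"

definition final_branch ::
  "(real \<Rightarrow> real) \<Rightarrow> real \<Rightarrow> real \<Rightarrow> (real \<Rightarrow> real) \<Rightarrow> (real \<Rightarrow> real) \<Rightarrow> real \<Rightarrow> real \<Rightarrow> (real \<Rightarrow> real) \<Rightarrow> bool"
where
  "final_branch \<kappa> T lb0 yb0 yb1 \<alpha> tb L \<longleftrightarrow>
     0 < tb \<and> tb < T \<and> C1_on {tb..T} L \<and>
     (\<forall>t\<in>{tb..T}.
        let x = t + L t - T; Y = \<bar>yb1 x + deriv_on {0..lb0} yb0 x\<bar>\<^sup>2; k = \<kappa> (L t) in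
          Y \<le> 2 * k \<and>
          deriv_on {tb..T} L t \<in> {0, (2 * k - Y) / (2 * k + Y)} \<inter> {0..<1}) \<and>
     L T = lb0 \<and> tb + L tb = T \<and> deriv_on {tb..T} L T = \<alpha>"

end

(* The incoming part of the final state prescribes f up to a constant near time T, and the final branch
   is the front that this wave f drives; likewise the initial branch is driven by the initial
   data. Griffith's criterion can be solved for f' along any front of speed in [0, 1), so it suffices to
   connect the two branches by a front with continuous speed, letting it rest for a moment where f' has
   to change sign. The control is then u = f - g. The final state is reached by the solution for this u,
   which is unique because the arrival time, as a function of t - l t, solves a Lipschitz ODE. *)

theory Submission
  imports Defs
begin

text \<open>The two speeds allowed on the final branch come from the reflection law. Differentiating
  g (t + l) = f (t - l) along the front gives (1 + l') g' = (1 - l') f', and the final state forces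
  f' (T - x) = (yb1 - yb0') / 2 and g' (T + x) = - (yb1 + yb0') / 2. With Y = (yb1 + yb0')^2,
  Griffith's criterion then leaves l' = 0 with Y \<le> 2 \<kappa>, or l' = (2 \<kappa> - Y) / (2
  \<kappa> + Y). The slope f' is prescribed on [- l0, 0] by the initial data and on [tb - L tb, T]
  by the final data. \<open>L tb < tb\<close> keeps these intervals apart, and in between f' is
  free, because the control enters f additively. The front crosses this gap between the times ts and
  tb and has the distance D = L tb - ts to cover. If an end speed is positive, a continuous speed
  cannot avoid moving there, so D must be positive: this is the strict inequality in the hypothesis.
  A moving front fixes the modulus of f' at a positive value; only a resting one lets f' pass
  through 0.\<close>

section \<open>One-sided derivatives on intervals and inverses of monotone functions\<close>

lemma C1_on_realI:
  fixes f :: "real \<Rightarrow> real"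
  assumes "\<And>s. s \<in> S \<Longrightarrow> (f has_real_derivative f' s) (at s within S)" "continuous_on S f'"
  shows "C1_on S f"
  unfolding C1_on_def
proof (intro exI[of _ "\<lambda>p h. f' p * h"] conjI ballI allI)
  show "(f has_derivative (*) (f' p)) (at p within S)" if "p \<in> S" for p
    using assms(1)[OF that] by (simp add: has_field_derivative_def)
  show "continuous_on S (\<lambda>p. f' p * h)" for h
    using assms(2) by (intro continuous_intros)
qed

lemma deriv_on_eq:
  assumes "(f has_real_derivative d) (at s within {a..b})" "a < b" "s \<in> {a..b}"
  shows "deriv_on {a..b} f s = d"
  unfolding deriv_on_def
  using assms vector_derivative_within_cbox[of a b s f d]
  by (simp add: has_real_derivative_iff_has_vector_derivative)

text \<open>\<open>C1_on\<close> uses Frechet derivatives so that it also serves for regions of the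
  plane; on the line, a linear map is multiplication by its value at 1.\<close>

lemma C1_on_interval:
  assumes "C1_on {a..b} f" "a < b"
  shows "s \<in> {a..b} \<Longrightarrow> (f has_real_derivative deriv_on {a..b} f s) (at s within {a..b})"
    and "continuous_on {a..b} (deriv_on {a..b} f)"
proof -
  from assms(1) obtain f' where f': "\<And>p. p \<in> {a..b} \<Longrightarrow> (f has_derivative f' p) (at p within {a..b})"
    and cont: "continuous_on {a..b} (\<lambda>p. f' p 1)"
    unfolding C1_on_def by blast
  have D: "(f has_real_derivative f' s 1) (at s within {a..b})" if "s \<in> {a..b}" for s
  proof (rule has_derivative_imp_has_field_derivative[OF f'[OF that]])
    show "h * f' s 1 = f' s h" for h
      using linear_cmul[OF has_derivative_linear[OF f'[OF that]], of h 1] by simp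
  qed
  have eq: "deriv_on {a..b} f s = f' s 1" if "s \<in> {a..b}" for s
    using deriv_on_eq[OF D[OF that] assms(2) that] .
  show "s \<in> {a..b} \<Longrightarrow> (f has_real_derivative deriv_on {a..b} f s) (at s within {a..b})"
    using D eq by simp
  show "continuous_on {a..b} (deriv_on {a..b} f)"
    by (rule continuous_on_eq[OF cont]) (simp add: eq)
qed

lemma eq_if_deriv_eq:
  fixes f g :: "real \<Rightarrow> real"
  assumes "\<And>s. s \<in> {a..b} \<Longrightarrow> (f has_real_derivative d s) (at s within {a..b})"
    and "\<And>s. s \<in> {a..b} \<Longrightarrow> (g has_real_derivative d s) (at s within {a..b})"
    and "c \<in> {a..b}" "f c = g c" "s \<in> {a..b}"
  shows "f s = g s"
proof -
  have "((\<lambda>s. f s - g s) has_real_derivative 0) (at s within {a..b})" if "s \<in> {a..b}" for s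
    using DERIV_diff[OF assms(1)[OF that] assms(2)[OF that]] by simp
  then obtain k where "\<And>s. s \<in> {a..b} \<Longrightarrow> f s - g s = k"
    using has_field_derivative_zero_constant[of "{a..b}" "\<lambda>s. f s - g s"] by auto
  then show ?thesis
    using assms(3-5) by (metis eq_iff_diff_eq_0)
qed

text \<open>A continuous injection of a compact interval is a homeomorphism onto its image. Applied
  to both t - l t and t + l t, the latter being inverted in \<open>reflect\<close>.\<close>

lemma strict_mono_on_the_inv_into:
  fixes h :: "real \<Rightarrow> real"
  assumes "a \<le> b" "continuous_on {a..b} h" "strict_mono_on {a..b} h"
  shows "inj_on h {a..b}" "h ` {a..b} = {h a..h b}"
    and "continuous_on {h a..h b} (the_inv_into {a..b} h)"
    and "s \<in> {h a..h b} \<Longrightarrow> the_inv_into {a..b} h s \<in> {a..b} \<and> h (the_inv_into {a..b} h s) = s"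
    and "t \<in> {a..b} \<Longrightarrow> the_inv_into {a..b} h (h t) = t"
proof -
  show inj: "inj_on h {a..b}"
    using assms(3) by (rule strict_mono_on_imp_inj_on)
  show im: "h ` {a..b} = {h a..h b}"
  proof
    show "h ` {a..b} \<subseteq> {h a..h b}"
      using strict_mono_on_leD[OF assms(3)] by auto
    show "{h a..h b} \<subseteq> h ` {a..b}"
      using IVT'[of h a _ b] assms(1,2) by force
  qed
  show "continuous_on {h a..h b} (the_inv_into {a..b} h)"
    using im the_inv_into_f_f[OF inj] continuous_on_inv[OF assms(2) compact_Icc, of "the_inv_into {a..b} h"] by auto
  show "s \<in> {h a..h b} \<Longrightarrow> the_inv_into {a..b} h s \<in> {a..b} \<and> h (the_inv_into {a..b} h s) = s"
    using im f_the_inv_into_f[OF inj] the_inv_into_into[OF inj _ order_refl] by metis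
  show "t \<in> {a..b} \<Longrightarrow> the_inv_into {a..b} h (h t) = t"
    by (rule the_inv_into_f_f[OF inj])
qed

section \<open>Griffith's criterion solved for the wave slope\<close>

lemma front_speed_range:
  assumes "0 \<le> q" "0 < k"
  shows "front_speed q k \<in> {0..<1}"
  using assms by (auto simp: front_speed_def field_simps)

text \<open>The left side is the derivative of the arrival time with respect to s = t - l t. In this
  form it depends on k only through q / (2 * k), which is Lipschitz in k away from 0.\<close>

lemma inverse_one_minus_front_speed:
  assumes "0 \<le> q" "0 < k"
  shows "inverse (1 - front_speed q k) = max (q / (2 * k) + 1/2) 1"
proof (cases "k \<le> q")
  case True
  have "1 - (q - k) / (q + k) = 2 * k / (q + k)" "0 \<le> (q - k) / (q + k)"
    "1 \<le> q / (2 * k) + 1/2" "inverse (2 * k / (q + k)) = q / (2 * k) + 1/2"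
    using assms True by (simp_all add: field_simps)
  then show ?thesis using assms by (simp add: front_speed_def max_def)
next
  case False
  then have "(q - k) / (q + k) \<le> 0" "q / (2 * k) + 1/2 \<le> 1"
    using assms by (simp_all add: field_simps)
  then show ?thesis by (simp add: front_speed_def max_def)
qed

text \<open>The positive root p of (2 p^2 - k) / (2 p^2 + k) = v, for v in [0, 1) and k > 0.\<close>

definition amplitude :: "real \<Rightarrow> real \<Rightarrow> real" where
  "amplitude v k = sqrt (k * (1 + v) / (2 * (1 - v)))"

lemma amplitude_pos: "v \<in> {0..<1} \<Longrightarrow> 0 < k \<Longrightarrow> 0 < amplitude v k"
  by (simp add: amplitude_def)

text \<open>The maximum in \<open>front_speed\<close> hides the size of p below the threshold: a
  resting front only bounds the slope, a moving one fixes it up to sign.\<close>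

lemma front_speed_eq_iff:
  assumes "v \<in> {0..<1}" "0 < k"
  shows "front_speed (2 * p\<^sup>2) k = v \<longleftrightarrow>
    \<bar>p\<bar> \<le> amplitude v k \<and> (0 < v \<longrightarrow> \<bar>p\<bar> = amplitude v k)"
proof -
  have amp: "2 * (amplitude v k)\<^sup>2 = k * (1 + v) / (1 - v)"
    using assms by (simp add: amplitude_def divide_simps)
  have le: "\<bar>p\<bar> \<le> amplitude v k \<longleftrightarrow> 2 * p\<^sup>2 \<le> k * (1 + v) / (1 - v)"
    unfolding amp[symmetric] using abs_le_square_iff[of p "amplitude v k"] amplitude_pos[OF assms] by simp
  have eq: "\<bar>p\<bar> = amplitude v k \<longleftrightarrow> 2 * p\<^sup>2 = k * (1 + v) / (1 - v)"
    unfolding amp[symmetric] using power2_eq_iff_nonneg[of "\<bar>p\<bar>" "amplitude v k"] amplitude_pos[OF assms] by simp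
  have q: "0 < 2 * p\<^sup>2 + k" using assms(2) by (simp add: add_nonneg_pos)
  show ?thesis
  proof (cases "0 < v")
    case True
    then have "front_speed (2 * p\<^sup>2) k = v \<longleftrightarrow> (2 * p\<^sup>2 - k) / (2 * p\<^sup>2 + k) = v"
      by (auto simp: front_speed_def max_def)
    also have "\<dots> \<longleftrightarrow> 2 * p\<^sup>2 = k * (1 + v) / (1 - v)"
    proof -
      have "(2 * p\<^sup>2 - k) / (2 * p\<^sup>2 + k) = v \<longleftrightarrow> 2 * p\<^sup>2 - k = v * (2 * p\<^sup>2 + k)"
        using q by (simp only: divide_eq_eq) simp
      also have "\<dots> \<longleftrightarrow> 2 * p\<^sup>2 * (1 - v) = k * (1 + v)"
        by (simp add: algebra_simps)
      also have "\<dots> \<longleftrightarrow> 2 * p\<^sup>2 = k * (1 + v) / (1 - v)"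
        using assms(1) by (simp only: eq_divide_eq) simp
      finally show ?thesis .
    qed
    finally show ?thesis using eq True by auto
  next
    case False
    then have v: "v = 0" using assms by auto
    have "front_speed (2 * p\<^sup>2) k = 0 \<longleftrightarrow> (2 * p\<^sup>2 - k) / (2 * p\<^sup>2 + k) \<le> 0"
      by (auto simp: front_speed_def max_def)
    also have "\<dots> \<longleftrightarrow> 2 * p\<^sup>2 \<le> k"
      using q by (simp add: divide_le_0_iff)
    finally show ?thesis using le v by simp
  qed
qed

section \<open>A speed profile with given end speeds and given integral\<close>

text \<open>Serves twice: applied to 1 - e it bounds the area of the end ramps from above, applied
  to the bump \<beta> it bounds that area from below.\<close>

lemma integral_ge_plateau:
  fixes h :: "real \<Rightarrow> real"
  assumes "continuous_on {p..q} h" "\<And>t. t \<in> {p..q} \<Longrightarrow> 0 \<le> h t"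
    and "\<And>t. t \<in> {p + d..q - d} \<Longrightarrow> h t = 1" "0 \<le> d" "2 * d \<le> q - p"
  shows "q - p - 2 * d \<le> integral {p..q} h"
proof -
  have "q - p - 2 * d = integral {p + d..q - d} (\<lambda>_. 1 :: real)"
    using assms(4,5) by simp
  also have "\<dots> = integral {p + d..q - d} h"
    by (rule integral_cong) (simp add: assms(3))
  also have "\<dots> \<le> integral {p..q} h"
    using assms
    by (intro integral_subset_le integrable_continuous_interval continuous_on_subset[OF assms(1)]) auto
  finally show ?thesis .
qed

text \<open>The front speed \<open>v\<close> is made to vanish shortly after \<open>p\<close> and shortly before \<open>q\<close>, where the
  normalised wave slope \<open>w\<close> is then free to change sign; a bump in between adjusts the distance
  travelled.\<close>

lemma connecting_profile:
  fixes p q a b D wa wb :: real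
  assumes ab: "a \<in> {0..<1}" "b \<in> {0..<1}" and D: "0 \<le> D" "D < q - p" "0 < a \<or> 0 < b \<Longrightarrow> 0 < D"
    and w: "\<bar>wa\<bar> \<le> 1" "\<bar>wb\<bar> \<le> 1" "0 < a \<Longrightarrow> \<bar>wa\<bar> = 1" "0 < b \<Longrightarrow> \<bar>wb\<bar> = 1"
  obtains v w where "continuous_on {p..q} v" "continuous_on {p..q} w"
    "v p = a" "v q = b" "w p = wa" "w q = wb"
    "\<And>t. t \<in> {p..q} \<Longrightarrow> v t \<in> {0..<1} \<and> \<bar>w t\<bar> \<le> 1 \<and> (0 < v t \<longrightarrow> \<bar>w t\<bar> = 1)"
    "integral {p..q} v = D"
proof -
  \<comment> \<open>The ramp width. The two ramps have area at most 2 * \<epsilon>, which must not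
    exceed D; the bump, at full height from 3 * \<epsilon> off each end, has area at least q - p - 6
    * \<epsilon>, which must exceed D. If D = 0 the ramps vanish, so only the second demand
    remains.\<close>
  define \<epsilon> where "\<epsilon> = (if D = 0 then (q - p) / 8 else min (D / 4) ((q - p - D) / 8))"
  have eps: "0 < \<epsilon>" "D + 8 * \<epsilon> \<le> q - p" "D \<noteq> 0 \<Longrightarrow> 2 * \<epsilon> \<le> D"
    using D(1,2) by (auto simp: \<epsilon>_def min_def divide_simps)
  define r :: "real \<Rightarrow> real" where "r x = max 0 (min 1 x)" for x
  have r: "0 \<le> r x" "r x \<le> 1" "x \<le> 0 \<Longrightarrow> r x = 0" "1 \<le> x \<Longrightarrow> r x = 1" for x
    by (auto simp: r_def)
  have r_cont: "continuous_on S (\<lambda>x. r (h x))" if "continuous_on S h" for S and h :: "real \<Rightarrow> real"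
    unfolding r_def using that by (intro continuous_intros)
  \<comment> \<open>Distances to the two ends in units of \<epsilon>. Their sum is at least 8, so
    the constructions at the two ends do not interfere.\<close>
  define x z where "x t = (t - p) / \<epsilon>" and "z t = (q - t) / \<epsilon>" for t
  have xz_cont: "continuous_on S x" "continuous_on S z" for S
    using eps(1) unfolding x_def z_def by (auto intro!: continuous_intros)
  have xz: "8 \<le> x t + z t" for t
  proof -
    have "x t + z t = (q - p) / \<epsilon>" by (simp add: x_def z_def diff_divide_distrib)
    then show ?thesis using eps D(1) by (simp add: pos_le_divide_eq)
  qed
  have xz_nonneg: "0 \<le> x t" "0 \<le> z t" if "t \<in> {p..q}" for t
    using that eps(1) by (auto simp: x_def z_def)
  \<comment> \<open>e falls from a to 0 within one unit of p and rises to b within one unit of q,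
    while \<beta> vanishes within two units of either end. In the second unit from each end the
    front is therefore at rest.\<close>
  define e where "e t = a * r (1 - x t) + b * r (1 - z t)" for t
  define \<beta> where "\<beta> t = r (x t - 2) * r (z t - 2)" for t
  have cont: "continuous_on {p..q} e" "continuous_on {p..q} \<beta>"
    unfolding e_def \<beta>_def by (intro continuous_intros r_cont xz_cont)+
  have e: "0 \<le> e t" "e t \<le> 1" for t
  proof -
    show "0 \<le> e t" unfolding e_def using ab r(1) by simp
    consider "1 \<le> x t" | "1 \<le> z t" using xz[of t] by linarith
    then show "e t \<le> 1"
      using mult_left_le[of "r (1 - x t)" a] mult_left_le[of "r (1 - z t)" b] ab r
      by cases (auto simp: e_def)
  qed
  define E K where "E = integral {p..q} e" and "K = integral {p..q} \<beta>"
  have "q - p - 2 * \<epsilon> \<le> integral {p..q} (\<lambda>t. 1 - e t)"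
  proof (rule integral_ge_plateau)
    fix t assume "t \<in> {p + \<epsilon>..q - \<epsilon>}"
    then have "1 \<le> x t" "1 \<le> z t" using eps(1) by (auto simp: x_def z_def field_simps)
    then show "1 - e t = 1" by (simp add: e_def r)
  qed (use e eps D in \<open>auto intro!: continuous_intros cont\<close>)
  also have "\<dots> = q - p - E"
    using D by (simp add: E_def Henstock_Kurzweil_Integration.integral_diff integrable_continuous_interval cont)
  finally have E: "E \<le> 2 * \<epsilon>" by simp
  have E0: "0 \<le> E" unfolding E_def
    by (intro Henstock_Kurzweil_Integration.integral_nonneg integrable_continuous_interval cont e)
  \<comment> \<open>The bound 2 * \<epsilon> does not help when D = 0; there E vanishes because both
    end speeds do.\<close>
  have "D = 0 \<Longrightarrow> a = 0 \<and> b = 0"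
    using D(3) ab by fastforce
  then have "D = 0 \<Longrightarrow> E = 0"
    by (simp add: E_def e_def[abs_def])
  then have ED: "E \<le> D" using E eps(3) by fastforce
  have "q - p - 2 * (3 * \<epsilon>) \<le> K" unfolding K_def
  proof (rule integral_ge_plateau[OF cont(2)])
    fix t assume "t \<in> {p + 3 * \<epsilon>..q - 3 * \<epsilon>}"
    then have "3 \<le> x t" "3 \<le> z t" using eps(1) by (auto simp: x_def z_def field_simps)
    then show "\<beta> t = 1" by (simp add: \<beta>_def r)
  qed (use r eps D in \<open>auto simp: \<beta>_def\<close>)
  then have K: "D < K" using eps by linarith
  \<comment> \<open>Solves E + c * K = D. Here c is nonnegative by E \<le> D and below 1 by D < K,
    so the bump is slower than the waves.\<close>
  define c where "c = (D - E) / K"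
  have c: "0 \<le> c" "c < 1" using K D E0 ED by (auto simp: c_def divide_simps)
  define v where "v t = e t + c * \<beta> t" for t
  \<comment> \<open>Moves from wa to 1 in the second unit after p and from 1 to wb in the second
    unit before q, exactly where v is 0.\<close>
  define w where "w t = 1 + (wa - 1) * r (2 - x t) + (wb - 1) * r (2 - z t)" for t
  show thesis
  proof
    show "continuous_on {p..q} v" "continuous_on {p..q} w"
      unfolding v_def w_def by (intro continuous_intros cont r_cont xz_cont)+
    have ends: "x p = 0" "z q = 0" "8 \<le> z p" "8 \<le> x q"
      using xz[of p] xz[of q] by (auto simp: x_def z_def)
    show "v p = a" "v q = b" "w p = wa" "w q = wb"
      using ends by (simp_all add: v_def w_def e_def \<beta>_def r)
    have "integral {p..q} v = E + c * K"
      unfolding v_def E_def K_def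
      by (subst Henstock_Kurzweil_Integration.integral_add)
        (auto intro!: integrable_continuous_interval continuous_intros cont)
    then show "integral {p..q} v = D" using K D by (simp add: c_def)
    \<comment> \<open>A convex combination of s and 1.\<close>
    have conv: "\<bar>1 + (s - 1) * r y\<bar> \<le> 1" if "\<bar>s\<bar> \<le> 1" for s y
    proof -
      have "0 \<le> (1 - s) * r y" "(1 - s) * r y \<le> 1 - s"
        using that r[of y] mult_left_le[of "r y" "1 - s"] by auto
      then show ?thesis using that by (auto simp: algebra_simps)
    qed
    fix t assume t: "t \<in> {p..q}"
    consider "x t \<le> 2" | "z t \<le> 2" | "2 < x t" "2 < z t" by linarith
    then show "v t \<in> {0..<1} \<and> \<bar>w t\<bar> \<le> 1 \<and> (0 < v t \<longrightarrow> \<bar>w t\<bar> = 1)"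
    proof cases
      case 1
      then have "6 \<le> z t" using xz[of t] by linarith
      then have vw: "v t = a * r (1 - x t)" "w t = 1 + (wa - 1) * r (2 - x t)"
        using 1 by (simp_all add: v_def w_def e_def \<beta>_def r)
      have "0 < v t \<Longrightarrow> 0 < a \<and> x t < 1"
        using vw(1) ab r[of "1 - x t"] by (cases "x t < 1") (auto simp: zero_less_mult_iff)
      then have "0 < v t \<Longrightarrow> 0 < a \<and> w t = wa" unfolding vw(2) by (simp add: r)
      moreover have "0 \<le> v t" "v t \<le> a"
        unfolding vw(1) using ab r[of "1 - x t"] mult_left_le[of "r (1 - x t)" a] by auto
      ultimately show ?thesis using conv[OF w(1)] w(3) ab vw(2) by auto
    next
      case 2
      then have "6 \<le> x t" using xz[of t] by linarith
      then have vw: "v t = b * r (1 - z t)" "w t = 1 + (wb - 1) * r (2 - z t)"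
        using 2 by (simp_all add: v_def w_def e_def \<beta>_def r)
      have "0 < v t \<Longrightarrow> 0 < b \<and> z t < 1"
        using vw(1) ab r[of "1 - z t"] by (cases "z t < 1") (auto simp: zero_less_mult_iff)
      then have "0 < v t \<Longrightarrow> 0 < b \<and> w t = wb" unfolding vw(2) by (simp add: r)
      moreover have "0 \<le> v t" "v t \<le> b"
        unfolding vw(1) using ab r[of "1 - z t"] mult_left_le[of "r (1 - z t)" b] by auto
      ultimately show ?thesis using conv[OF w(2)] w(4) ab vw(2) by auto
    next
      case 3
      then have vw: "v t = c * \<beta> t" "w t = 1"
        by (simp_all add: v_def w_def e_def r)
      have "0 \<le> \<beta> t" "\<beta> t \<le> 1"
        unfolding \<beta>_def using r[of "x t - 2"] r[of "z t - 2"] by (auto intro: mult_le_one)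
      then show ?thesis using c mult_left_le[of "\<beta> t" c] unfolding vw by auto
    qed
  qed
qed

section \<open>Geometry of a front with speed in [0, 1)\<close>

lemma mvt_deriv:
  fixes h :: "real \<Rightarrow> real"
  assumes "\<And>t. t \<in> {a..b} \<Longrightarrow> (h has_real_derivative h' t) (at t within {a..b})"
    and "a \<le> s" "s < t" "t \<le> b"
  obtains r where "r \<in> {s<..<t}" "h t - h s = h' r * (t - s)"
proof -
  have "\<exists>r\<in>{s<..<t}. h t - h s = h' r * (t - s)"
    using assms(2-4)
    by (intro mvt_simple)
      (auto simp: has_field_derivative_def[symmetric] intro!: has_field_derivative_subset[OF assms(1)])
  then show thesis using that by blast
qed

lemma mono_if_deriv_nonneg:
  fixes h :: "real \<Rightarrow> real"
  assumes "\<And>t. t \<in> {a..b} \<Longrightarrow> (h has_real_derivative h' t) (at t within {a..b})"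
    and "\<And>t. t \<in> {a..b} \<Longrightarrow> 0 \<le> h' t" and "a \<le> s" "s \<le> t" "t \<le> b"
  shows "h s \<le> h t"
proof (cases "s < t")
  case True
  then obtain r where "r \<in> {s<..<t}" "h t - h s = h' r * (t - s)"
    using mvt_deriv[OF assms(1), of s t] assms(3,5) by auto
  moreover from this have "0 \<le> h' r * (t - s)" using assms(2)[of r] assms(3,5) by simp
  ultimately show ?thesis by simp
qed (use assms(4) in auto)

text \<open>No law for the speed is assumed, so the locale fits the initial branch, the constructed
  front and the front of an arbitrary solution. Speed below 1 makes t - l t strictly increasing;
  nonnegative speed does the same for t + l t.\<close>

locale front =
  fixes T l0 :: real and l v :: "real \<Rightarrow> real"
  assumes T_pos: "0 < T" and l0_pos: "0 < l0" and l_0: "l 0 = l0"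
    and l_deriv: "\<And>t. t \<in> {0..T} \<Longrightarrow> (l has_real_derivative v t) (at t within {0..T})"
    and v_cont: "continuous_on {0..T} v"
    and v_range: "\<And>t. t \<in> {0..T} \<Longrightarrow> v t \<in> {0..<1}"
begin

lemma l_cont: "continuous_on {0..T} l"
  unfolding continuous_on_eq_continuous_within using DERIV_continuous[OF l_deriv] by blast

lemma l_increment:
  assumes "0 \<le> s" "s \<le> t" "t \<le> T"
  shows "l s \<le> l t" "s < t \<Longrightarrow> l t - l s < t - s"
proof -
  show "l s \<le> l t"
    using mono_if_deriv_nonneg[OF l_deriv, of s t] v_range assms by auto
  assume st: "s < t"
  obtain r where "r \<in> {s<..<t}" "l t - l s = v r * (t - s)"
    using mvt_deriv[OF l_deriv, of s t] st assms by auto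
  then show "l t - l s < t - s"
    using v_range[of r] st assms by auto
qed

lemma l_ge: "t \<in> {0..T} \<Longrightarrow> l0 \<le> l t"
  using l_increment(1)[of 0 t] l_0 by auto

lemma l_pos: "t \<in> {0..T} \<Longrightarrow> 0 < l t"
  using l_ge l0_pos by force

lemma l_le: "t \<in> {0..T} \<Longrightarrow> l t \<le> l0 + T"
  using l_increment(2)[of 0 t] l_0 T_pos l0_pos by (cases "t = 0") auto

lemma minus_mono: "strict_mono_on {0..T} (\<lambda>t. t - l t)"
  using l_increment(2) by (force intro!: strict_mono_onI)

lemma plus_mono: "strict_mono_on {0..T} (\<lambda>t. t + l t)"
  using l_increment(1) by (force intro!: strict_mono_onI add_less_le_mono)

text \<open>The time at which the outgoing characteristic t - x = s meets the front.\<close>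

definition arrival :: "real \<Rightarrow> real" where
  "arrival = the_inv_into {0..T} (\<lambda>t. t - l t)"

text \<open>The time at which the incoming characteristic t + x = s leaves the front.\<close>

definition departure :: "real \<Rightarrow> real" where
  "departure = the_inv_into {0..T} (\<lambda>t. t + l t)"

lemma arrival_cont: "continuous_on {- l0..T - l T} arrival"
  and arrival: "s \<in> {- l0..T - l T} \<Longrightarrow> arrival s \<in> {0..T} \<and> arrival s - l (arrival s) = s"
  and arrival_minus: "t \<in> {0..T} \<Longrightarrow> arrival (t - l t) = t"
  using strict_mono_on_the_inv_into(3-5)[OF _ continuous_on_diff[OF continuous_on_id l_cont] minus_mono]
    T_pos l_0
  by (auto simp: arrival_def)

lemma departure_cont: "continuous_on {l0..T + l T} departure"
  and departure: "s \<in> {l0..T + l T} \<Longrightarrow> departure s \<in> {0..T} \<and> departure s + l (departure s) = s"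
  and departure_plus: "t \<in> {0..T} \<Longrightarrow> departure (t + l t) = t"
  using strict_mono_on_the_inv_into(3-5)[OF _ continuous_on_add[OF continuous_on_id l_cont] plus_mono]
    T_pos l_0
  by (auto simp: departure_def)

lemma reflect_eq: "reflect T l s = departure s - l (departure s)"
  by (simp add: reflect_def departure_def Let_def)

lemma reflect_plus: "t \<in> {0..T} \<Longrightarrow> reflect T l (t + l t) = t - l t"
  by (simp add: reflect_eq departure_plus)

lemma minus_range: "t \<in> {0..T} \<Longrightarrow> t - l t \<in> {- l0..T - l T}"
  using strict_mono_on_leD[OF minus_mono, of 0 t] strict_mono_on_leD[OF minus_mono, of t T] l_0 by auto

lemma plus_range: "t \<in> {0..T} \<Longrightarrow> t + l t \<in> {l0..T + l T}"
  using strict_mono_on_leD[OF plus_mono, of 0 t] strict_mono_on_leD[OF plus_mono, of t T] l_0 by auto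

text \<open>Only interior points, as the inverse function rule is two-sided; the comparison of two
  fronts covers the end points by continuity.\<close>

lemma arrival_deriv:
  assumes "s \<in> {- l0<..<T - l T}"
  shows "(arrival has_real_derivative inverse (1 - v (arrival s))) (at s)"
proof (rule DERIV_inverse_function[where a = "- l0" and b = "T - l T" and f = "\<lambda>t. t - l t"])
  have a: "arrival s \<in> {0..T}" "arrival s - l (arrival s) = s" using arrival[of s] assms by auto
  moreover have "arrival s \<noteq> 0" "arrival s \<noteq> T" using a assms l_0 by auto
  ultimately have i: "arrival s \<in> {0<..<T}" by auto
  then have "(l has_real_derivative v (arrival s)) (at (arrival s))"
    using l_deriv[of "arrival s"] by (simp add: at_within_Icc_at)
  then show "((\<lambda>t. t - l t) has_real_derivative 1 - v (arrival s)) (at (arrival s))"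
    by (intro derivative_intros) auto
  show "1 - v (arrival s) \<noteq> 0" using v_range[OF a(1)] by auto
  show "isCont arrival s"
    using continuous_on_interior[OF arrival_cont, of s] assms by auto
qed (use assms arrival in auto)

end

section \<open>Uniqueness of the front driven by a given wave\<close>

text \<open>Gronwall's argument: d^2 * exp (- 2 K s) is nonnegative, does not increase and starts at
  0.\<close>

lemma zero_if_deriv_le:
  fixes d :: "real \<Rightarrow> real"
  assumes "continuous_on {a..b} d" "d a = 0"
    and "\<And>s. s \<in> {a<..<b} \<Longrightarrow> (d has_real_derivative d' s) (at s) \<and> \<bar>d' s\<bar> \<le> K * \<bar>d s\<bar>"
    and "s \<in> {a..b}"
  shows "d s = 0"
proof -
  define E where "E s = (d s)\<^sup>2 * exp (- (2 * K) * s)" for s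
  have "E s \<le> E a"
  proof (rule DERIV_nonpos_imp_decreasing_open[of a s])
    fix r assume "a < r" "r < s"
    then have d: "(d has_real_derivative d' r) (at r)" "\<bar>d' r\<bar> \<le> K * \<bar>d r\<bar>"
      using assms(3)[of r] assms(4) by auto
    have "(E has_real_derivative 2 * d r * d' r * exp (- (2 * K) * r) - 2 * K * (d r)\<^sup>2 * exp (- (2 * K) * r)) (at r)"
      unfolding E_def by (auto intro!: derivative_eq_intros d(1) simp: power2_eq_square algebra_simps)
    moreover have "d r * d' r \<le> K * (d r)\<^sup>2"
    proof -
      have "d r * d' r \<le> \<bar>d r\<bar> * \<bar>d' r\<bar>" by (metis abs_ge_self abs_mult)
      also have "\<dots> \<le> \<bar>d r\<bar> * (K * \<bar>d r\<bar>)" using d(2) by (intro mult_left_mono) auto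
      finally show ?thesis by (simp add: power2_eq_square algebra_simps)
    qed
    then have "2 * d r * d' r * exp (- (2 * K) * r) \<le> 2 * K * (d r)\<^sup>2 * exp (- (2 * K) * r)"
      by (intro mult_right_mono) auto
    ultimately show "\<exists>y. (E has_real_derivative y) (at r) \<and> y \<le> 0" by force
  next
    show "continuous_on {a..s} E"
      unfolding E_def using assms(4)
      by (intro continuous_intros continuous_on_subset[OF assms(1)]) auto
  qed (use assms(4) in auto)
  then have "(d s)\<^sup>2 * exp (- (2 * K) * s) \<le> 0" using assms(2) by (simp add: E_def)
  then show ?thesis by (simp add: mult_le_0_iff)
qed

lemma toughness_bounds:
  assumes "toughness c1 c2 \<kappa>" "0 \<le> x"
  shows "c1 \<le> \<kappa> x" "0 < c1" "0 < \<kappa> x"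
  using assms unfolding toughness_def by force+

lemma toughness_lipschitz:
  assumes "toughness c1 c2 \<kappa>" "0 \<le> a"
  obtains K where "0 \<le> K" "\<And>x y. x \<in> {a..b} \<Longrightarrow> y \<in> {a..b} \<Longrightarrow> \<bar>\<kappa> x - \<kappa> y\<bar> \<le> K * \<bar>x - y\<bar>"
proof -
  have "local_lipschitz (UNIV :: real set) {0..} (\<lambda>_. \<kappa>)" using assms(1) by (simp add: toughness_def)
  then have "local_lipschitz {0 :: real} {a..b} (\<lambda>_. \<kappa>)"
    by (rule local_lipschitz_subset) (use assms(2) in auto)
  from local_lipschitz_compact_implies_lipschitz[OF this]
  obtain K where "\<And>t. t \<in> {0 :: real} \<Longrightarrow> K-lipschitz_on {a..b} \<kappa>"
    by (auto simp: continuous_on_const)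
  then have "K-lipschitz_on {a..b} \<kappa>" by simp
  then show thesis
    using that lipschitz_onD[of K "{a..b}" \<kappa>] lipschitz_on_nonneg[of K "{a..b}" \<kappa>]
    by (force simp: dist_real_def)
qed

text \<open>Compares the arrival-time equations of two fronts that meet the same characteristic at
  places of different toughness; A stands for the squared wave slope.\<close>

lemma max_one_lipschitz:
  fixes A k1 k2 c :: real
  assumes "0 \<le> A" "0 < c" "c \<le> k1" "c \<le> k2"
  shows "\<bar>max (A / k1 + 1/2) 1 - max (A / k2 + 1/2) 1\<bar> \<le> A / c\<^sup>2 * \<bar>k1 - k2\<bar>"
proof -
  have "\<bar>A / k1 - A / k2\<bar> = A * \<bar>k1 - k2\<bar> / (k1 * k2)"
  proof -
    have "A / k1 - A / k2 = A * (k2 - k1) / (k1 * k2)"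
      using assms by (simp add: field_simps)
    then show ?thesis using assms by (simp add: abs_mult abs_minus_commute)
  qed
  also have "\<dots> \<le> A * \<bar>k1 - k2\<bar> / c\<^sup>2"
    using assms by (intro divide_left_mono) (auto simp: power2_eq_square intro: mult_mono)
  finally show ?thesis by (auto simp: max_def)
qed

text \<open>As a function of \<open>t\<close> the front solves an ODE that is merely continuous in the unknown. In the
  variable \<open>s = t - l t\<close> the arrival time solves one with a Lipschitz right-hand side.\<close>

lemma front_unique:
  assumes F1: "front T l0 l1 v1" and F2: "front T l0 l2 v2" and \<kappa>: "toughness c1 c2 \<kappa>"
    and S: "- l0 < S" and \<phi>: "continuous_on {- l0..S} \<phi>"
    and v1: "\<And>t. t \<in> {0..T} \<Longrightarrow> t - l1 t \<le> S \<Longrightarrow> v1 t = front_speed (2 * (\<phi> (t - l1 t))\<^sup>2) (\<kappa> (l1 t))"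
    and v2: "\<And>t. t \<in> {0..T} \<Longrightarrow> t - l2 t \<le> S \<Longrightarrow> v2 t = front_speed (2 * (\<phi> (t - l2 t))\<^sup>2) (\<kappa> (l2 t))"
    and t: "t \<in> {0..T}" "t - l1 t \<le> S"
  shows "l2 t = l1 t"
proof -
  interpret f1: front T l0 l1 v1 by (rule F1)
  interpret f2: front T l0 l2 v2 by (rule F2)
  \<comment> \<open>Up to m both arrival times exist and both speed laws are available.\<close>
  define m where "m = min S (min (T - l1 T) (T - l2 T))"
  have m: "m \<le> S" "m \<le> T - l1 T" "m \<le> T - l2 T" by (auto simp: m_def)
  obtain K where K: "0 \<le> K"
    "\<And>x y. x \<in> {l0..l0 + T} \<Longrightarrow> y \<in> {l0..l0 + T} \<Longrightarrow> \<bar>\<kappa> x - \<kappa> y\<bar> \<le> K * \<bar>x - y\<bar>"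
    using toughness_lipschitz[OF \<kappa>] f1.l0_pos by (metis less_imp_le)
  obtain M where M: "\<And>s. s \<in> {- l0..S} \<Longrightarrow> (\<phi> s)\<^sup>2 \<le> M"
  proof -
    have "bounded ((\<lambda>s. (\<phi> s)\<^sup>2) ` {- l0..S})"
      by (intro compact_imp_bounded compact_continuous_image continuous_intros \<phi>) auto
    then obtain M where "\<forall>s\<in>{- l0..S}. norm ((\<phi> s)\<^sup>2) \<le> M" unfolding bounded_iff by auto
    then show thesis using that[of M] by auto
  qed
  have M0: "0 \<le> M" using M[of "- l0"] S order_trans[OF zero_le_power2] by auto
  have c1: "0 < c1" using \<kappa> by (simp add: toughness_def)
  define d' where "d' s = inverse (1 - v1 (f1.arrival s)) - inverse (1 - v2 (f2.arrival s))" for s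
  have eq: "f1.arrival s - f2.arrival s = 0" if "s \<in> {- l0..m}" for s
  proof (rule zero_if_deriv_le[of "- l0" m "\<lambda>s. f1.arrival s - f2.arrival s" d' "M / c1\<^sup>2 * K"])
    show "continuous_on {- l0..m} (\<lambda>s. f1.arrival s - f2.arrival s)"
      using m by (intro continuous_intros continuous_on_subset[OF f1.arrival_cont]
          continuous_on_subset[OF f2.arrival_cont]) auto
    show "f1.arrival (- l0) - f2.arrival (- l0) = 0"
      using f1.arrival_minus[of 0] f2.arrival_minus[of 0] f1.T_pos f1.l_0 f2.l_0 by simp
    show "s \<in> {- l0..m}" by (rule that)
    fix s assume s: "s \<in> {- l0<..<m}"
    then have a1: "f1.arrival s \<in> {0..T}" "f1.arrival s - l1 (f1.arrival s) = s"
      and a2: "f2.arrival s \<in> {0..T}" "f2.arrival s - l2 (f2.arrival s) = s"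
      using f1.arrival[of s] f2.arrival[of s] m by auto
    let ?k1 = "\<kappa> (l1 (f1.arrival s))" and ?k2 = "\<kappa> (l2 (f2.arrival s))"
    have k: "c1 \<le> ?k1" "c1 \<le> ?k2"
      using toughness_bounds[OF \<kappa>] f1.l_pos[OF a1(1)] f2.l_pos[OF a2(1)] by (auto simp: less_imp_le)
    have "inverse (1 - v1 (f1.arrival s)) = max ((\<phi> s)\<^sup>2 / ?k1 + 1/2) 1"
      "inverse (1 - v2 (f2.arrival s)) = max ((\<phi> s)\<^sup>2 / ?k2 + 1/2) 1"
      using v1[OF a1(1)] v2[OF a2(1)] a1 a2 s m k c1 by (auto simp: inverse_one_minus_front_speed)
    then have "\<bar>d' s\<bar> \<le> (\<phi> s)\<^sup>2 / c1\<^sup>2 * \<bar>?k1 - ?k2\<bar>"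
      unfolding d'_def using k c1 by (simp only:) (rule max_one_lipschitz, auto)
    also have "\<dots> \<le> M / c1\<^sup>2 * (K * \<bar>l1 (f1.arrival s) - l2 (f2.arrival s)\<bar>)"
      using M[of s] M0 s m a1 a2 f1.l_ge f1.l_le f2.l_ge f2.l_le
      by (intro mult_mono K divide_right_mono) auto
    \<comment> \<open>Both meeting points lie on the characteristic s, so positions differ exactly
      as arrival times do. This closes the estimate in the unknown itself.\<close>
    also have "l1 (f1.arrival s) - l2 (f2.arrival s) = f1.arrival s - f2.arrival s"
      using a1(2) a2(2) by simp
    finally have "\<bar>d' s\<bar> \<le> M / c1\<^sup>2 * K * \<bar>f1.arrival s - f2.arrival s\<bar>" by (simp add: mult.assoc)
    moreover have "((\<lambda>s. f1.arrival s - f2.arrival s) has_real_derivative d' s) (at s)"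
      unfolding d'_def using s m by (intro derivative_intros f1.arrival_deriv f2.arrival_deriv) auto
    ultimately show "((\<lambda>s. f1.arrival s - f2.arrival s) has_real_derivative d' s) (at s) \<and>
      \<bar>d' s\<bar> \<le> M / c1\<^sup>2 * K * \<bar>f1.arrival s - f2.arrival s\<bar>" by simp
  qed
  define s where "s = t - l1 t"
  have s: "s \<in> {- l0..T - l1 T}" "s \<le> S" "f1.arrival s = t"
    using f1.minus_range[OF t(1)] t f1.arrival_minus by (auto simp: s_def)
  \<comment> \<open>Otherwise both arrival times at the parameter T - l2 T equal T, so the fronts
    end at the same place, although s lies beyond the range of one and within that of the
    other.\<close>
  have "s \<le> T - l2 T"
  proof (rule ccontr)
    assume less: "\<not> s \<le> T - l2 T"
    then have "m = T - l2 T" using s by (auto simp: m_def)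
    then have "f1.arrival (T - l2 T) = T"
      using eq[of m] f2.arrival_minus[of T] f2.minus_range[of T] f1.T_pos by auto
    then have "T - l1 T = T - l2 T"
      using f1.arrival[of "T - l2 T"] f2.minus_range[of T] f1.T_pos less s(1) by auto
    then show False using less s(1) by auto
  qed
  then have "f2.arrival s = t" "s \<in> {- l0..T - l2 T}" using eq[of s] s by (auto simp: m_def)
  then show ?thesis using f2.arrival[of s] s_def by auto
qed

section \<open>Realising a prescribed wave by a boundary control\<close>

lemma DERIV_compose_within:
  fixes F g :: "real \<Rightarrow> real"
  assumes "(F has_real_derivative d) (at (g s) within B)" "(g has_real_derivative e) (at s within A)"
    and "g ` A \<subseteq> B"
  shows "((\<lambda>s. F (g s)) has_real_derivative d * e) (at s within A)"
  using DERIV_image_chain[OF has_field_derivative_subset[OF assms(1,3)] assms(2)]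
  by (simp add: o_def)

lemma continuous_on_glue:
  fixes f g :: "real \<Rightarrow> real"
  assumes "continuous_on {a..c} f" "continuous_on {c..b} g" "f c = g c"
  shows "continuous_on {a..b} (\<lambda>x. if x \<le> c then f x else g x)"
proof (rule continuous_on_cases_le)
  show "continuous_on {x \<in> {a..b}. x \<le> c} f" "continuous_on {x \<in> {a..b}. c \<le> x} g"
    by (rule continuous_on_subset[OF assms(1)] continuous_on_subset[OF assms(2)]; auto)+
qed (use assms(3) in auto)

lemma region_arguments:
  assumes "front T l0 l v" "(t, x) \<in> region T l"
  shows "t - x \<in> {- l0..T}" "t + x \<in> {0..T + l T}"
proof -
  interpret front T l0 l v by (rule assms)
  have "t \<in> {0..T}" "x \<le> l t" "0 \<le> x" using assms(2) by (auto simp: region_def)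
  then show "t - x \<in> {- l0..T}" "t + x \<in> {0..T + l T}"
    using minus_range[of t] plus_range[of t] by auto
qed

lemma C1_on_region:
  assumes "front T l0 l v"
    and f: "\<And>s. s \<in> {- l0..T} \<Longrightarrow> (f has_real_derivative \<phi> s) (at s within {- l0..T})"
    and g: "\<And>s. s \<in> {0..T + l T} \<Longrightarrow> (g has_real_derivative \<gamma> s) (at s within {0..T + l T})"
    and \<phi>: "continuous_on {- l0..T} \<phi>" and \<gamma>: "continuous_on {0..T + l T} \<gamma>"
    and y: "\<And>t x. (t, x) \<in> region T l \<Longrightarrow> y t x = f (t - x) - g (t + x)"
  shows "C1_on (region T l) (case_prod y)"
  unfolding C1_on_def
proof (intro exI[of _ "\<lambda>p h. \<phi> (fst p - snd p) * (fst h - snd h) - \<gamma> (fst p + snd p) * (fst h + snd h)"]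
    conjI ballI allI)
  note rng = region_arguments[OF assms(1)]
  let ?R = "region T l"
  have sub: "(\<lambda>p. fst p - snd p) ` ?R \<subseteq> {- l0..T}" "(\<lambda>p. fst p + snd p) ` ?R \<subseteq> {0..T + l T}"
    using rng by (auto simp del: atLeastAtMost_iff)
  fix p assume p: "p \<in> ?R"
  then have "fst p - snd p \<in> {- l0..T}" "fst p + snd p \<in> {0..T + l T}" using sub by auto
  note d = f[OF this(1), unfolded has_field_derivative_def, THEN has_derivative_subset, OF sub(1)]
    g[OF this(2), unfolded has_field_derivative_def, THEN has_derivative_subset, OF sub(2)]
  have "((\<lambda>p. f (fst p - snd p) - g (fst p + snd p)) has_derivative
    (\<lambda>h. \<phi> (fst p - snd p) * (fst h - snd h) - \<gamma> (fst p + snd p) * (fst h + snd h))) (at p within ?R)"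
    by (intro has_derivative_diff has_derivative_in_compose[OF _ d(1)] has_derivative_in_compose[OF _ d(2)]
        has_derivative_add has_derivative_fst has_derivative_snd has_derivative_ident)
  then show "(case_prod y has_derivative
    (\<lambda>h. \<phi> (fst p - snd p) * (fst h - snd h) - \<gamma> (fst p + snd p) * (fst h + snd h))) (at p within ?R)"
    by (rule has_derivative_transform[OF p, rotated]) (auto simp: y)
next
  note rng = region_arguments[OF assms(1)]
  show "continuous_on (region T l)
    (\<lambda>p. \<phi> (fst p - snd p) * (fst h - snd h) - \<gamma> (fst p + snd p) * (fst h + snd h))" for h :: "real \<times> real"
    by (intro continuous_intros continuous_on_compose2[OF \<phi>] continuous_on_compose2[OF \<gamma>])
      (use rng in \<open>auto simp del: atLeastAtMost_iff\<close>)
qed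

text \<open>Reflection at the front determines g from f, and the control is the boundary value f -
  g. A jump of g' could arise only at s = l0, where the initial data hand over to the reflected
  wave; \<open>compat\<close> excludes it.\<close>

lemma (in front) C1_solution_exists:
  fixes \<kappa> y0 y1 \<phi> :: "real \<Rightarrow> real"
  defines "p \<equiv> deriv_on {0..l0} y0"
  assumes "l0 < T" and y0: "C1_on {0..l0} y0" and y1: "continuous_on {0..l0} y1"
    and compat: "y1 l0 = - v 0 * p l0"
    and \<phi>: "continuous_on {- l0..T} \<phi>"
    and \<phi>_init: "\<And>s. s \<in> {- l0..0} \<Longrightarrow> \<phi> s = (y1 (- s) - p (- s)) / 2"
    and speed: "\<And>t. t \<in> {0..T} \<Longrightarrow> v t = front_speed (2 * (\<phi> (t - l t))\<^sup>2) (\<kappa> (l t))"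
  obtains u f where "C1_on {0..T} u"
    "\<And>s. s \<in> {- l0..T} \<Longrightarrow> (f has_real_derivative \<phi> s) (at s within {- l0..T})"
    "C1_solution \<kappa> l0 y0 y1 T u l (\<lambda>t x. f (t - x) - incoming_wave l0 y0 y1 T u l f (t + x))"
proof -
  have p: "continuous_on {0..l0} p"
    unfolding p_def by (rule C1_on_interval(2)[OF y0 l0_pos])
  have T: "0 \<le> T" "T < T + l T" "l0 \<le> T + l T" using T_pos l_pos[of T] l_ge[of T] by auto

  \<comment> \<open>Normalised by f 0 = 0, as the first formula of \<open>outgoing_wave\<close>
    demands.\<close>
  define f where "f s = integral {- l0..s} \<phi> - integral {- l0..0} \<phi>" for s
  have f: "(f has_real_derivative \<phi> s) (at s within {- l0..T})" if "s \<in> {- l0..T}" for s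
    unfolding f_def using DERIV_diff[OF integral_has_real_derivative[OF \<phi> that] DERIV_const] by simp
  have f0: "f 0 = 0" by (simp add: f_def)
  have f_init: "f s = 1/2 * integral {0..- s} (\<lambda>\<sigma>. p \<sigma> - y1 \<sigma>)" if "s \<in> {- l0..0}" for s
  proof (rule eq_if_deriv_eq[of "- l0" 0 f \<phi> _ 0 s])
    fix s assume s: "s \<in> {- l0..0}"
    show "(f has_real_derivative \<phi> s) (at s within {- l0..0})"
      by (rule has_field_derivative_subset[OF f]) (use s T in auto)
    have "((\<lambda>s. integral {0..s} (\<lambda>\<sigma>. p \<sigma> - y1 \<sigma>)) has_real_derivative p (- s) - y1 (- s))
      (at (- s) within {0..l0})"
      by (rule integral_has_real_derivative) (use s in \<open>auto intro!: continuous_intros p y1\<close>)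
    moreover have "(uminus has_real_derivative - 1) (at s within {- l0..0})"
      by (auto intro!: derivative_eq_intros)
    moreover have "uminus ` {- l0..0} \<subseteq> {0..l0}" by auto
    ultimately have "((\<lambda>s. integral {0..- s} (\<lambda>\<sigma>. p \<sigma> - y1 \<sigma>)) has_real_derivative (p (- s) - y1 (- s)) * -1)
      (at s within {- l0..0})"
      by (rule DERIV_compose_within)
    from DERIV_cmult[OF this, of "1/2"]
    have "((\<lambda>s. 1/2 * integral {0..- s} (\<lambda>\<sigma>. p \<sigma> - y1 \<sigma>)) has_real_derivative
      1/2 * ((p (- s) - y1 (- s)) * - 1)) (at s within {- l0..0})" .
    moreover have "1/2 * ((p (- s) - y1 (- s)) * - 1) = \<phi> s" using \<phi>_init[OF s] by simp
    ultimately show "((\<lambda>s. 1/2 * integral {0..- s} (\<lambda>\<sigma>. p \<sigma> - y1 \<sigma>)) has_real_derivative \<phi> s)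
      (at s within {- l0..0})"
      by metis
  qed (use that f0 l0_pos in auto)

  \<comment> \<open>The slope of g beyond l0, from g' (1 + v) = f' (1 - v) at the time
    \<open>departure s\<close>.\<close>
  define \<rho> where "\<rho> s = \<phi> (reflect T l s) * (1 - v (departure s)) / (1 + v (departure s))" for s
  define \<gamma> where "\<gamma> s = (if s \<le> l0 then - (p s + y1 s) / 2 else \<rho> s)" for s
  have dep0: "departure l0 = 0" using departure_plus[of 0] T l_0 by simp
  have \<rho>0: "- (p l0 + y1 l0) / 2 = \<rho> l0"
  proof -
    have \<phi>0: "\<phi> (- l0) = - (1 + v 0) * p l0 / 2"
      using compat \<phi>_init[of "- l0"] l0_pos by (simp add: algebra_simps)
    have "\<rho> l0 = - (p l0 * (1 - v 0)) / 2"
      using v_range[of 0] T by (simp add: \<rho>_def dep0 reflect_eq l_0 \<phi>0 divide_simps) (simp add: algebra_simps)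
    then show ?thesis using compat by (simp add: algebra_simps)
  qed
  have \<rho>_cont: "continuous_on {l0..T + l T} \<rho>"
  proof -
    have r: "departure s \<in> {0..T}" "departure s - l (departure s) \<in> {- l0..T}" "1 + v (departure s) \<noteq> 0"
      if "s \<in> {l0..T + l T}" for s
      using departure[OF that] minus_range[of "departure s"] v_range[of "departure s"] l_pos[of T] T by auto
    have "continuous_on {l0..T + l T} (\<lambda>s. v (departure s))" "continuous_on {l0..T + l T} (\<lambda>s. l (departure s))"
      by (rule continuous_on_compose2[OF v_cont departure_cont] continuous_on_compose2[OF l_cont departure_cont];
          use r in blast)+
    moreover from this have "continuous_on {l0..T + l T} (\<lambda>s. \<phi> (departure s - l (departure s)))"
      by (intro continuous_on_compose2[OF \<phi>] continuous_intros departure_cont) (use r in blast)+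
    ultimately show ?thesis
      unfolding \<rho>_def reflect_eq by (intro continuous_intros) (use r in auto)
  qed
  have \<gamma>: "continuous_on {0..T + l T} \<gamma>"
    unfolding \<gamma>_def using \<rho>0 by (intro continuous_on_glue \<rho>_cont continuous_intros p y1) auto
  have \<gamma>_out: "\<gamma> s = \<rho> s" if "l0 \<le> s" for s
    using that \<rho>0 by (cases "s = l0") (auto simp: \<gamma>_def)

  \<comment> \<open>This is y0 0 - y0 l0, the value for which g l0 = f (- l0).\<close>
  define u0 where "u0 = - integral {0..l0} p"
  define g where "g s = - u0 + integral {0..s} \<gamma>" for s
  have g: "(g has_real_derivative \<gamma> s) (at s within {0..T + l T})" if "s \<in> {0..T + l T}" for s
    unfolding g_def using DERIV_add[OF DERIV_const[of "- u0"] integral_has_real_derivative[OF \<gamma> that]] by simp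
  have g_in: "g s = - u0 - 1/2 * integral {0..s} (\<lambda>\<sigma>. p \<sigma> + y1 \<sigma>)" if "s \<in> {0..l0}" for s
  proof -
    have "integral {0..s} \<gamma> = integral {0..s} (\<lambda>\<sigma>. - (1/2) * (p \<sigma> + y1 \<sigma>))"
      by (rule integral_cong) (use that in \<open>simp add: \<gamma>_def field_simps\<close>)
    then show ?thesis unfolding g_def integral_mult_right by simp
  qed
  \<comment> \<open>The displacement vanishes on the front: the derivatives agree by the choice of
    \<rho>, the values at t = 0 by that of \<open>u0\<close>.\<close>
  have g_out: "g (t + l t) = f (t - l t)" if "t \<in> {0..T}" for t
  proof (rule eq_if_deriv_eq[of 0 T "\<lambda>t. g (t + l t)" _ "\<lambda>t. f (t - l t)" 0 t])
    fix t assume t: "t \<in> {0..T}"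
    have "((\<lambda>t. g (t + l t)) has_real_derivative \<gamma> (t + l t) * (1 + v t)) (at t within {0..T})"
      by (rule DERIV_compose_within[OF g])
        (use plus_range t l0_pos in \<open>force intro!: derivative_eq_intros l_deriv\<close>)+
    moreover have "\<gamma> (t + l t) * (1 + v t) = \<phi> (t - l t) * (1 - v t)"
      using \<gamma>_out[of "t + l t"] plus_range[OF t] v_range[OF t]
      by (simp add: \<rho>_def departure_plus[OF t] reflect_plus[OF t])
    ultimately show "((\<lambda>t. g (t + l t)) has_real_derivative \<phi> (t - l t) * (1 - v t)) (at t within {0..T})"
      by simp
    show "((\<lambda>t. f (t - l t)) has_real_derivative \<phi> (t - l t) * (1 - v t)) (at t within {0..T})"
      by (rule DERIV_compose_within[OF f])
        (use minus_range t l_pos[of T] T in \<open>force intro!: derivative_eq_intros l_deriv\<close>)+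
  next
    have "integral {0..l0} (\<lambda>\<sigma>. p \<sigma> - y1 \<sigma>) = integral {0..l0} p - integral {0..l0} y1"
      "integral {0..l0} (\<lambda>\<sigma>. p \<sigma> + y1 \<sigma>) = integral {0..l0} p + integral {0..l0} y1"
      by (intro Henstock_Kurzweil_Integration.integral_diff Henstock_Kurzweil_Integration.integral_add
          integrable_continuous_interval p y1)+
    then show "g (0 + l 0) = f (0 - l 0)"
      using g_in[of l0] f_init[of "- l0"] l0_pos by (simp add: l_0 u0_def field_simps)
  qed (use that T in auto)
  have g_reflect: "g s = f (reflect T l s)" if "s \<in> {l0..T + l T}" for s
    using g_out[of "departure s"] departure[OF that] by (simp add: reflect_eq)

  define u where "u s = f s - g s" for s
  have u0: "u 0 = u0" using f0 by (simp add: u_def g_def)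
  have wave: "incoming_wave l0 y0 y1 T u l f s = g s" if "s \<in> {0..T + l T}" for s
    using that g_in[of s] g_reflect[of s] by (auto simp: incoming_wave_def u0 p_def)
  let ?y = "\<lambda>t x. f (t - x) - incoming_wave l0 y0 y1 T u l f (t + x)"
  have F: "front T l0 l v" by (rule front_axioms)
  have "C1_on {0..T} u"
  proof (rule C1_on_realI[of _ _ "\<lambda>s. \<phi> s - \<gamma> s"])
    show "(u has_real_derivative \<phi> s - \<gamma> s) (at s within {0..T})" if "s \<in> {0..T}" for s
      unfolding u_def
      by (intro derivative_intros has_field_derivative_subset[OF f] has_field_derivative_subset[OF g])
        (use that T l0_pos in auto)
    show "continuous_on {0..T} (\<lambda>s. \<phi> s - \<gamma> s)"
      by (intro continuous_intros continuous_on_subset[OF \<phi>] continuous_on_subset[OF \<gamma>])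
        (use T l0_pos in auto)
  qed
  moreover have "C1_solution \<kappa> l0 y0 y1 T u l ?y"
    unfolding C1_solution_def
  proof (intro conjI ballI exI[of _ f])
    show "C1_on {0..T} l" by (rule C1_on_realI[OF l_deriv v_cont])
    show "C1_on {- l0..T} f" by (rule C1_on_realI[OF f \<phi>])
    show "C1_on (region T l) (case_prod ?y)"
      by (rule C1_on_region[OF F f g \<phi> \<gamma>]) (simp_all add: wave region_arguments[OF F] del: atLeastAtMost_iff)
    show "outgoing_wave l0 y0 y1 T u l f"
      unfolding outgoing_wave_def
    proof (intro conjI ballI impI)
      show "f s = u s - u 0 - 1/2 * integral {0..s} (\<lambda>\<sigma>. deriv_on {0..l0} y0 \<sigma> + y1 \<sigma>)"
        if "s \<in> {0<..l0}" for s
        using g_in[of s] that by (simp add: u0 p_def) (simp add: u_def)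
      show "f s = u s + f (reflect T l s)" if "s \<in> {l0<..T}" for s
        using g_reflect[of s] that T by (simp add: u_def)
    qed (use f_init in \<open>simp add: p_def\<close>)
    fix t assume t: "t \<in> {0..T}"
    have "t - l t \<in> {- l0..T}" using minus_range[OF t] l_pos[of T] T by auto
    then show "deriv_on {0..T} l t = front_speed (2 * (deriv_on {- l0..T} f (t - l t))\<^sup>2) (\<kappa> (l t))"
      using deriv_on_eq[OF l_deriv[OF t] T_pos t] deriv_on_eq[OF f, of "t - l t"] speed[OF t] T_pos l0_pos by simp
  qed (auto simp: l_pos l_0)
  ultimately show thesis using that f by blast
qed

section \<open>Uniqueness of the solution for a given control\<close>

lemma C1_solution_front:
  assumes "toughness c1 c2 \<kappa>" "0 < l0" "0 < T" "C1_solution \<kappa> l0 y0 y1 T u l y"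
  shows "front T l0 l (deriv_on {0..T} l)"
proof
  have l: "C1_on {0..T} l" "l 0 = l0" "\<And>t. t \<in> {0..T} \<Longrightarrow> 0 < l t"
    using assms(4) by (auto simp: C1_solution_def)
  note d = C1_on_interval[OF l(1) assms(3)]
  show "0 < T" "0 < l0" "l 0 = l0" "continuous_on {0..T} (deriv_on {0..T} l)" by fact+
  show "(l has_real_derivative deriv_on {0..T} l t) (at t within {0..T})" if "t \<in> {0..T}" for t
    using d(1)[OF that] .
  show "deriv_on {0..T} l t \<in> {0..<1}" if "t \<in> {0..T}" for t
  proof -
    obtain f where f: "\<forall>t\<in>{0..T}. deriv_on {0..T} l t =
        front_speed (2 * (deriv_on {- l0..T} f (t - l t))\<^sup>2) (\<kappa> (l t))"
      using assms(4) unfolding C1_solution_def by (elim conjE exE) (rule that)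
    show ?thesis
      unfolding bspec[OF f that]
      using toughness_bounds(3)[OF assms(1), of "l t"] l(3)[OF that] by (intro front_speed_range) auto
  qed
qed

lemma DERIV_transform_within_set:
  assumes "(f has_field_derivative d) (at s within A)" "s \<in> A" "\<And>r. r \<in> A \<Longrightarrow> g r = f r"
  shows "(g has_field_derivative d) (at s within A)"
  using assms unfolding has_field_derivative_def by (metis has_derivative_transform)

text \<open>Waves that agree only up to S have equal slopes even at S itself, because a one-sided
  derivative there already determines the derivative relative to the larger interval.\<close>

lemma deriv_on_subinterval:
  assumes "C1_on {a..b} f" "{c..d} \<subseteq> {a..b}" "c < d" "s \<in> {c..d}"
    and "\<And>r. r \<in> {c..d} \<Longrightarrow> g r = f r"
  shows "deriv_on {c..d} g s = deriv_on {a..b} f s"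
proof (rule deriv_on_eq)
  have "a < b" using assms by auto
  then have "(f has_real_derivative deriv_on {a..b} f s) (at s within {c..d})"
    using assms by (intro has_field_derivative_subset[OF C1_on_interval(1)[OF assms(1)]]) auto
  then show "(g has_real_derivative deriv_on {a..b} f s) (at s within {c..d})"
    using assms(4,5) by (rule DERIV_transform_within_set)
qed (use assms in auto)

text \<open>Within time \<open>l0\<close> a wave cannot travel to the front and back, so agreement of the outgoing waves
  up to \<open>S\<close> propagates through the front to agreement up to \<open>S + l0\<close>.\<close>

lemma C1_solution_unique:
  assumes \<kappa>: "toughness c1 c2 \<kappa>" and l0: "0 < l0" and T: "0 < T"
    and S1: "C1_solution \<kappa> l0 y0 y1 T u l y" and S2: "C1_solution \<kappa> l0 y0 y1 T u l' y'"
  shows "t \<in> {0..T} \<Longrightarrow> l' t = l t" and "(t, x) \<in> region T l \<Longrightarrow> y' t x = y t x"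
proof -
  obtain f where f: "C1_on {- l0..T} f" "outgoing_wave l0 y0 y1 T u l f"
    and lf: "\<And>t. t \<in> {0..T} \<Longrightarrow> deriv_on {0..T} l t =
      front_speed (2 * (deriv_on {- l0..T} f (t - l t))\<^sup>2) (\<kappa> (l t))"
    and y: "\<And>t x. (t, x) \<in> region T l \<Longrightarrow> y t x = f (t - x) - incoming_wave l0 y0 y1 T u l f (t + x)"
    using S1 unfolding C1_solution_def by blast
  obtain f' where f': "C1_on {- l0..T} f'" "outgoing_wave l0 y0 y1 T u l' f'"
    and lf': "\<And>t. t \<in> {0..T} \<Longrightarrow> deriv_on {0..T} l' t =
      front_speed (2 * (deriv_on {- l0..T} f' (t - l' t))\<^sup>2) (\<kappa> (l' t))"
    and y': "\<And>t x. (t, x) \<in> region T l' \<Longrightarrow> y' t x = f' (t - x) - incoming_wave l0 y0 y1 T u l' f' (t + x)"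
    using S2 unfolding C1_solution_def by blast
  note F = C1_solution_front[OF \<kappa> l0 T S1] and F' = C1_solution_front[OF \<kappa> l0 T S2]
  interpret a: front T l0 l "deriv_on {0..T} l" by (rule F)
  interpret b: front T l0 l' "deriv_on {0..T} l'" by (rule F')

  have fronts: "l' t = l t"
    if S: "0 < S" "S \<le> T" "\<And>s. s \<in> {- l0..S} \<Longrightarrow> f' s = f s" and t: "t \<in> {0..T}" "t - l t \<le> S" for S t
  proof (rule front_unique[OF F F' \<kappa>])
    let ?\<phi> = "deriv_on {- l0..T} f"
    have "deriv_on {- l0..S} f s = ?\<phi> s" "deriv_on {- l0..S} f s = deriv_on {- l0..T} f' s"
      if "s \<in> {- l0..S}" for s
      using S l0 that by (auto intro!: deriv_on_subinterval f(1) f'(1))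
    then have \<phi>': "deriv_on {- l0..T} f' s = ?\<phi> s" if "s \<in> {- l0..S}" for s
      using that by simp
    show "- l0 < S" using S l0 by simp
    show "continuous_on {- l0..S} ?\<phi>"
      using S T l0 by (intro continuous_on_subset[OF C1_on_interval(2)[OF f(1)]]) auto
    show "deriv_on {0..T} l t = front_speed (2 * (?\<phi> (t - l t))\<^sup>2) (\<kappa> (l t))" if "t \<in> {0..T}" for t
      by (rule lf[OF that])
    show "deriv_on {0..T} l' t = front_speed (2 * (?\<phi> (t - l' t))\<^sup>2) (\<kappa> (l' t))"
      if "t \<in> {0..T}" "t - l' t \<le> S" for t
      using lf'[OF that(1)] \<phi>'[of "t - l' t"] b.minus_range[OF that(1)] that(2) by simp
  qed (use t in auto)

  have waves: "f' s = f s" if "s \<in> {- l0..T}" "s \<le> real (Suc n) * l0" for n s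
    using that
  proof (induction n arbitrary: s)
    case 0
    \<comment> \<open>Up to l0 both waves are explicit in the data and the control; the front does
      not enter.\<close>
    then consider "s \<in> {- l0..0}" | "s \<in> {0<..l0}" "s \<le> T" by fastforce
    then show ?case
    proof cases
      case 1
      have "f s = 1/2 * integral {0..- s} (\<lambda>\<sigma>. deriv_on {0..l0} y0 \<sigma> - y1 \<sigma>)"
        "f' s = 1/2 * integral {0..- s} (\<lambda>\<sigma>. deriv_on {0..l0} y0 \<sigma> - y1 \<sigma>)"
        using f(2) f'(2) 1 unfolding outgoing_wave_def by blast+
      then show ?thesis by (simp only:)
    next
      case 2
      then show ?thesis using f(2) f'(2) unfolding outgoing_wave_def by simp
    qed
  next
    case (Suc n)
    \<comment> \<open>The factor \<open>Suc n\<close> keeps the bound positive, as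
      \<open>fronts\<close> requires.\<close>
    let ?S = "min T (real (Suc n) * l0)"
    show ?case
    proof (cases "s \<le> ?S")
      case True
      then show ?thesis using Suc by simp
    next
      case False
      have "l0 \<le> real (Suc n) * l0" using l0 by simp
      then have s: "s \<in> {l0<..T}" "s \<le> T + l T"
        using False Suc.prems(1) a.l_pos[of T] T by auto
      define t where "t = a.departure s"
      have t: "t \<in> {0..T}" "t + l t = s" using a.departure[of s] s by (auto simp: t_def)
      \<comment> \<open>t - l t = s - 2 * l t \<le> s - 2 * l0, so reflection falls back by at least
        two steps of length l0.\<close>
      have tS: "t - l t \<le> ?S"
        using t a.l_ge[OF t(1)] Suc.prems(2) a.l_pos[of t] l0 by (auto simp: algebra_simps)
      have "l' t = l t"
        by (rule fronts[of ?S]) (use Suc.IH t tS T l0 in auto)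
      then have "reflect T l' s = t - l t" "reflect T l s = t - l t"
        using a.reflect_plus[OF t(1)] b.reflect_plus[OF t(1)] t(2) by simp_all
      moreover have "f' (t - l t) = f (t - l t)"
        using Suc.IH[of "t - l t"] a.minus_range[OF t(1)] tS by auto
      ultimately show ?thesis using f(2) f'(2) s(1) unfolding outgoing_wave_def by simp
    qed
  qed
  obtain n where "T / l0 \<le> real n" using real_arch_simple by blast
  then have "T \<le> real (Suc n) * l0" using l0 by (simp add: divide_le_eq algebra_simps)
  then have f_eq: "f' s = f s" if "s \<in> {- l0..T}" for s
    using waves[OF that, of n] that by auto
  \<comment> \<open>Agreement of the waves up to T covers the whole front, since t - l t <
    T.\<close>
  have l_eq: "l' t = l t" if "t \<in> {0..T}" for t
    using fronts[OF T order_refl f_eq that] a.minus_range[OF that] a.l_pos[of T] T by auto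
  then show "t \<in> {0..T} \<Longrightarrow> l' t = l t" .
  assume tx: "(t, x) \<in> region T l"
  then have tx': "(t, x) \<in> region T l'" using l_eq by (auto simp: region_def)
  note rng = region_arguments[OF F tx]
  have "incoming_wave l0 y0 y1 T u l' f' (t + x) = incoming_wave l0 y0 y1 T u l f (t + x)"
  proof (cases "t + x \<le> l0")
    case False
    define r where "r = a.departure (t + x)"
    have r: "r \<in> {0..T}" "r + l r = t + x" using a.departure[of "t + x"] False rng by (auto simp: r_def)
    then have "reflect T l' (t + x) = r - l r" "reflect T l (t + x) = r - l r"
      using a.reflect_plus[OF r(1)] b.reflect_plus[OF r(1)] l_eq by simp_all
    moreover have "r - l r \<in> {- l0..T}" using a.minus_range[OF r(1)] a.l_pos[of T] T by auto
    ultimately show ?thesis using False f_eq by (simp add: incoming_wave_def)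
  qed (simp add: incoming_wave_def)
  then show "y' t x = y t x" using y[OF tx] y'[OF tx'] f_eq rng(1) by simp
qed

section \<open>Reading off the final state\<close>

text \<open>Only the derivative relative to the region is available at time \<open>T\<close>; its time component is
  recovered from the slice at time \<open>T\<close> and one characteristic direction, \<open>(- 1, - 1)\<close> for \<open>x > 0\<close>
  and \<open>(- 1, 1)\<close> for \<open>x = 0\<close>.\<close>

lemma (in front) terminal_state:
  fixes f \<phi> yb0 yb1 :: "real \<Rightarrow> real"
  defines "p \<equiv> deriv_on {0..l T} yb0"
  assumes "l0 < T"
    and f: "\<And>s. s \<in> {- l0..T} \<Longrightarrow> (f has_real_derivative \<phi> s) (at s within {- l0..T})"
    and yb0: "C1_on {0..l T} yb0" "yb0 (l T) = 0"
    and tb: "tb \<in> {0..T}" "tb + l tb = T"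
    and \<phi>_end: "\<And>x. x \<in> {0..l T} \<Longrightarrow> T - x \<ge> - l0 \<Longrightarrow> \<phi> (T - x) = (yb1 x - p x) / 2"
    and \<phi>_front: "\<And>t. t \<in> {tb..T} \<Longrightarrow>
      (1 - v t) * \<phi> (t - l t) = - (1 + v t) * (yb1 (t + l t - T) + p (t + l t - T)) / 2"
    and y: "\<And>t x. (t, x) \<in> region T l \<Longrightarrow> y t x = f (t - x) - incoming_wave l0 y0 y1 T u l f (t + x)"
    and y_C1: "C1_on (region T l) (case_prod y)"
    and x: "x \<in> {0..l T}"
  shows "y T x = yb0 x" "partial_t (region T l) y T x = yb1 x"
proof -
  have lT: "0 < l T" "l T \<le> T + l0" using l_pos[of T] minus_range[of T] T_pos by auto
  have p: "\<And>x. x \<in> {0..l T} \<Longrightarrow> (yb0 has_real_derivative p x) (at x within {0..l T})"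
    unfolding p_def using C1_on_interval(1)[OF yb0(1) lT(1)] .
  have rng: "t + l t - T \<in> {0..l T}" "t - l t \<in> {- l0..T}" "t \<in> {0..T}" if "t \<in> {tb..T}" for t
    using that tb lT strict_mono_on_leD[OF plus_mono, of tb t] plus_range[of t] minus_range[of t] by auto
  \<comment> \<open>With x = t + l t - T, the left side is the value of - g (T + x) that produces
    yb0 at time T. The hypotheses on \<phi> make the derivatives agree; the identity is anchored at
    t = T, where x = l T and yb0 vanishes.\<close>
  have front_value: "yb0 (t + l t - T) - f (2 * T - t - l t) = - f (t - l t)" if "t \<in> {tb..T}" for t
  proof (rule eq_if_deriv_eq[of tb T "\<lambda>t. yb0 (t + l t - T) - f (2 * T - t - l t)"
        "\<lambda>t. - (\<phi> (t - l t) * (1 - v t))" "\<lambda>t. - f (t - l t)" T t])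
    fix t assume t: "t \<in> {tb..T}"
    let ?x = "t + l t - T"
    have l: "(l has_real_derivative v t) (at t within {tb..T})"
      by (rule has_field_derivative_subset[OF l_deriv]) (use rng[OF t] tb in auto)
    have "((\<lambda>t. yb0 (t + l t - T)) has_real_derivative p ?x * (1 + v t)) (at t within {tb..T})"
      by (rule DERIV_compose_within[OF p])
        (use rng t in \<open>auto simp del: atLeastAtMost_iff intro!: derivative_eq_intros l\<close>)
    moreover have "2 * T - t - l t \<in> {- l0..T}" if "t \<in> {tb..T}" for t
      using rng[OF that] lT by auto
    then have "((\<lambda>t. f (2 * T - t - l t)) has_real_derivative \<phi> (2 * T - t - l t) * - (1 + v t)) (at t within {tb..T})"
      using t by (intro DERIV_compose_within[OF f])
        (auto simp del: atLeastAtMost_iff intro!: derivative_eq_intros l)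
    ultimately have "((\<lambda>t. yb0 (t + l t - T) - f (2 * T - t - l t)) has_real_derivative
      p ?x * (1 + v t) - \<phi> (2 * T - t - l t) * - (1 + v t)) (at t within {tb..T})"
      by (rule DERIV_diff)
    moreover have x: "2 * T - t - l t = T - ?x" by simp
    have \<phi>x: "\<phi> (2 * T - t - l t) = (yb1 ?x - p ?x) / 2"
      unfolding x by (rule \<phi>_end) (use rng[OF t] lT in auto)
    have "p ?x * (1 + v t) - \<phi> (2 * T - t - l t) * - (1 + v t) = (1 + v t) * (yb1 ?x + p ?x) / 2"
      unfolding \<phi>x by (simp add: field_simps)
    then have "p ?x * (1 + v t) - \<phi> (2 * T - t - l t) * - (1 + v t) = - (\<phi> (t - l t) * (1 - v t))"
      using \<phi>_front[OF t] by (simp only: mult.commute[of _ "1 - v t"])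
    ultimately show "((\<lambda>t. yb0 (t + l t - T) - f (2 * T - t - l t)) has_real_derivative
      - (\<phi> (t - l t) * (1 - v t))) (at t within {tb..T})"
      by simp
    have "((\<lambda>t. f (t - l t)) has_real_derivative \<phi> (t - l t) * (1 - v t)) (at t within {tb..T})"
      by (rule DERIV_compose_within[OF f])
        (use rng t in \<open>auto simp del: atLeastAtMost_iff intro!: derivative_eq_intros l\<close>)
    then show "((\<lambda>t. - f (t - l t)) has_real_derivative - (\<phi> (t - l t) * (1 - v t))) (at t within {tb..T})"
      by (rule DERIV_minus)
  qed (use that tb yb0 in auto)
  have wave: "incoming_wave l0 y0 y1 T u l f (T + x) = f (T - x) - yb0 x" if "x \<in> {0..l T}" for x
  proof -
    define t where "t = departure (T + x)"
    have t: "t \<in> {0..T}" "t + l t = T + x" using departure[of "T + x"] that \<open>l0 < T\<close> by (auto simp: t_def)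
    \<comment> \<open>Since tb + l tb = T, a characteristic that is inside the region at time T left
      the front no earlier than tb.\<close>
    have "tb \<le> t"
      using strict_mono_onD[OF plus_mono, of t tb] t tb that by force
    then have "yb0 x - f (T - x) = - f (t - l t)"
      using front_value[of t] t by (simp add: algebra_simps)
    then show ?thesis
      using reflect_plus[OF t(1)] t(2) that \<open>l0 < T\<close> by (simp add: incoming_wave_def)
  qed
  have slice: "y T x = yb0 x" if "x \<in> {0..l T}" for x
    using y[of T x] wave[OF that] that T_pos by (auto simp: region_def)
  then show "y T x = yb0 x" using x .

  let ?R = "region T l" and ?D = "frechet_derivative (case_prod y) (at (T, x) within region T l)"
  have TR: "(T, x) \<in> ?R" using x T_pos by (simp add: region_def)
  have D: "(case_prod y has_derivative ?D) (at (T, x) within ?R)"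
    using y_C1 TR unfolding C1_on_def
    by (auto simp: frechet_derivative_works[symmetric] differentiable_def)
  \<comment> \<open>Chain rule on a segment from (T, x) into the region. Derivatives relative to an
    interval of positive length are unique, so any computed slope k is the value of ?D.\<close>
  have along: "?D d = k"
    if h: "0 < h" and cR: "\<And>r. r \<in> {0..h} \<Longrightarrow> (T, x) + r *\<^sub>R d \<in> ?R"
      and k: "((\<lambda>r. case_prod y ((T, x) + r *\<^sub>R d)) has_real_derivative k) (at 0 within {0..h})"
    for h k d
  proof -
    have "((\<lambda>r. (T, x) + r *\<^sub>R d) has_derivative (\<lambda>r. r *\<^sub>R d)) (at 0 within {0..h})"
      by (auto intro!: derivative_eq_intros)
    moreover have "(case_prod y has_derivative ?D) (at ((T, x) + 0 *\<^sub>R d) within (\<lambda>r. (T, x) + r *\<^sub>R d) ` {0..h})"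
      using D cR by (auto intro!: has_derivative_subset[OF D])
    ultimately have "((\<lambda>r. case_prod y ((T, x) + r *\<^sub>R d)) has_derivative (\<lambda>r. ?D (r *\<^sub>R d))) (at 0 within {0..h})"
      by (rule has_derivative_in_compose)
    moreover have "?D (r *\<^sub>R d) = ?D d * r" for r
      using linear_cmul[OF has_derivative_linear[OF D]] by simp
    ultimately have "((\<lambda>r. case_prod y ((T, x) + r *\<^sub>R d)) has_real_derivative ?D d) (at 0 within {0..h})"
      by (simp add: has_field_derivative_def)
    moreover have "0 \<in> {0..h}" using h by simp
    ultimately show ?thesis
      using trans[OF deriv_on_eq[symmetric] deriv_on_eq, OF _ h _ k h] by blast
  qed
  note D_diff = linear_diff[OF has_derivative_linear[OF D]]
  show "partial_t ?R y T x = yb1 x"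
  proof (cases "x = 0")
    case False
    then have x0: "0 < x" using x by simp
    have 1: "?D (0, - 1) = - p x"
    proof (rule along[OF x0])
      show "(T, x) + r *\<^sub>R (0, - 1) \<in> ?R" if "r \<in> {0..x}" for r
        using that x T_pos by (auto simp: region_def)
      have "((\<lambda>r. yb0 (x - r)) has_real_derivative p (x - 0) * - 1) (at 0 within {0..x})"
        by (rule DERIV_compose_within[OF p]) (use x in \<open>auto intro!: derivative_eq_intros\<close>)
      then have "((\<lambda>r. yb0 (x - r)) has_real_derivative - p x) (at 0 within {0..x})" by simp
      then show "((\<lambda>r. case_prod y ((T, x) + r *\<^sub>R (0, - 1))) has_real_derivative - p x) (at 0 within {0..x})"
        by (rule DERIV_transform_within_set[where f = "\<lambda>r. yb0 (x - r)"]) (use slice x x0 in auto)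
    qed
    \<comment> \<open>Keeps T - r and x - 2 * r nonnegative on the segment; it stays behind the
      front because the front is slower than 1.\<close>
    define h where "h = min T (x / 2)"
    have h: "0 < h" "h \<le> T" "2 * h \<le> x" using T_pos x0 by (auto simp: h_def)
    have 2: "?D (- 1, - 1) = - (yb1 x + p x)"
    proof (rule along[OF h(1)])
      have R: "(T - r, x - r) \<in> ?R" if "r \<in> {0..h}" for r
        using that h x l_increment(2)[of "T - r" T] by (cases "r = 0") (auto simp: region_def)
      then show "(T, x) + r *\<^sub>R (- 1, - 1) \<in> ?R" if "r \<in> {0..h}" for r
        using that by auto
      \<comment> \<open>Along (- 1, - 1) the argument t - x is constant; only the incoming part
        varies, and \<open>wave\<close> expresses it by the final data.\<close>
      let ?F = "\<lambda>r. f (T - x) - (f (T - x + 2 * r) - yb0 (x - 2 * r))"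
      have eq: "y (T - r) (x - r) = ?F r" if "r \<in> {0..h}" for r
        using y[OF R[OF that]] wave[of "x - 2 * r"] that h x by (auto simp: algebra_simps)
      have "((\<lambda>r. f (T - x + 2 * r)) has_real_derivative \<phi> (T - x + 2 * 0) * 2) (at 0 within {0..h})"
        by (rule DERIV_compose_within[OF f]) (use x h lT in \<open>auto intro!: derivative_eq_intros\<close>)
      moreover have "((\<lambda>r. yb0 (x - 2 * r)) has_real_derivative p (x - 2 * 0) * - 2) (at 0 within {0..h})"
        by (rule DERIV_compose_within[OF p]) (use x h in \<open>auto intro!: derivative_eq_intros\<close>)
      ultimately have "(?F has_real_derivative 0 - (\<phi> (T - x + 2 * 0) * 2 - p (x - 2 * 0) * - 2)) (at 0 within {0..h})"
        by (intro DERIV_diff DERIV_const)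
      moreover have "0 - (\<phi> (T - x + 2 * 0) * 2 - p (x - 2 * 0) * - 2) = - (yb1 x + p x)"
        using \<phi>_end[OF x] x lT by simp
      ultimately have "(?F has_real_derivative - (yb1 x + p x)) (at 0 within {0..h})" by (rule DERIV_cong)
      then show "((\<lambda>r. case_prod y ((T, x) + r *\<^sub>R (- 1, - 1))) has_real_derivative - (yb1 x + p x)) (at 0 within {0..h})"
        by (rule DERIV_transform_within_set[where f = ?F]) (use eq h in auto)
    qed
    have "?D (1, 0) = ?D ((0, - 1) - (- 1, - 1))" by simp
    then show ?thesis unfolding partial_t_def D_diff 1 2 by simp
  next
    case True
    \<comment> \<open>Keeps r below l0, hence behind the front, and T - 2 * r in the domain of
      f.\<close>
    define h where "h = min T (l 0 / 2)"
    have h: "0 < h" "h \<le> T" "2 * h \<le> l0" using T_pos l_0 l0_pos by (auto simp: h_def)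
    have hl: "h \<le> l t" if "t \<in> {0..T}" for t using h l_ge[OF that] by auto
    have 1: "?D (0, 1) = p 0"
    proof (rule along[OF lT(1)])
      show "(T, x) + r *\<^sub>R (0, 1) \<in> ?R" if "r \<in> {0..l T}" for r
        using that True T_pos by (auto simp: region_def)
      show "((\<lambda>r. case_prod y ((T, x) + r *\<^sub>R (0, 1))) has_real_derivative p 0) (at 0 within {0..l T})"
        by (rule DERIV_transform_within_set[OF p[of 0]]) (use slice lT True in auto)
    qed
    have 2: "?D (- 1, 1) = - (yb1 0 - p 0)"
    proof (rule along[OF h(1)])
      have R: "(T - r, r) \<in> ?R" if "r \<in> {0..h}" for r
        using that h hl[of "T - r"] by (auto simp: region_def)
      then show "(T, x) + r *\<^sub>R (- 1, 1) \<in> ?R" if "r \<in> {0..h}" for r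
        using that True by auto
      \<comment> \<open>Along (- 1, 1) the argument t + x stays at T; only the outgoing part
        varies.\<close>
      let ?F = "\<lambda>r. f (T - 2 * r) - (f T - yb0 0)"
      have eq: "y (T - r) r = ?F r" if "r \<in> {0..h}" for r
        using y[OF R[OF that]] wave[of 0] lT by (auto simp: algebra_simps)
      have "((\<lambda>r. f (T - 2 * r)) has_real_derivative \<phi> (T - 2 * 0) * - 2) (at 0 within {0..h})"
        by (rule DERIV_compose_within[OF f]) (use h l0_pos T_pos in \<open>auto intro!: derivative_eq_intros\<close>)
      then have "(?F has_real_derivative \<phi> (T - 2 * 0) * - 2 - 0) (at 0 within {0..h})"
        by (intro DERIV_diff DERIV_const)
      moreover have "\<phi> (T - 2 * 0) * - 2 - 0 = - (yb1 0 - p 0)"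
        using \<phi>_end[of 0] lT T_pos l0_pos by simp
      ultimately have "(?F has_real_derivative - (yb1 0 - p 0)) (at 0 within {0..h})" by (rule DERIV_cong)
      then show "((\<lambda>r. case_prod y ((T, x) + r *\<^sub>R (- 1, 1))) has_real_derivative - (yb1 0 - p 0)) (at 0 within {0..h})"
        by (rule DERIV_transform_within_set[where f = ?F]) (use eq h True in auto)
    qed
    have "?D (1, 0) = ?D ((0, 1) - (- 1, 1))" by simp
    then show ?thesis unfolding partial_t_def D_diff 1 2 using True by simp
  qed
qed

section \<open>Joining the initial and the final branch\<close>

text \<open>\<psi> t is the slope f' (t - l t) met by the front at time t. In the time variable the
  three pieces live on the fixed intervals [0, ts], [ts, tb] and [tb, T], so the slope can be glued
  together with the speed.\<close>

lemma matching_front: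
  fixes l0 lb0 T \<alpha> tb ts :: real and \<kappa> y0 y1 yb0 yb1 li L :: "real \<Rightarrow> real"
  defines "p \<equiv> deriv_on {0..l0} y0" and "pb \<equiv> deriv_on {0..lb0} yb0"
  assumes \<kappa>: "toughness c1 c2 \<kappa>" and l0: "0 < l0"
    and y0: "C1_on {0..l0} y0" and y1: "continuous_on {0..l0} y1"
    and yb0: "C1_on {0..lb0} yb0" and yb1: "continuous_on {0..lb0} yb1"
    and fin: "final_branch \<kappa> T lb0 yb0 yb1 \<alpha> tb L"
    and init: "initial_branch \<kappa> l0 y0 y1 ts li"
    and sep: "if deriv_on {0..ts} li ts = 0 \<and> deriv_on {tb..T} L tb = 0
      then li ts \<le> L tb else li ts < L tb"
    and Ltb: "L tb < tb"
  obtains l v \<psi> where "front T l0 l v" "continuous_on {0..T} \<psi>"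
    "\<And>t. t \<in> {0..T} \<Longrightarrow> v t = front_speed (2 * (\<psi> t)\<^sup>2) (\<kappa> (l t))"
    "ts \<in> {0..T}" "l ts = ts"
    "\<And>t. t \<in> {0..ts} \<Longrightarrow> \<psi> t = (y1 (l t - t) - p (l t - t)) / 2"
    "\<And>t. t \<in> {tb..T} \<Longrightarrow> l t = L t \<and> v t = deriv_on {tb..T} L t"
    "\<And>t. t \<in> {tb..T} \<Longrightarrow>
      (1 - v t) * \<psi> t = - (1 + v t) * (yb1 (t + l t - T) + pb (t + l t - T)) / 2"
proof -
  define li' L' where "li' = deriv_on {0..ts} li" and "L' = deriv_on {tb..T} L"
  have ts: "0 < ts" and li: "C1_on {0..ts} li" "li 0 = l0" "li ts = ts"
    and li'_eq: "\<And>t. t \<in> {0..ts} \<Longrightarrow>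
      li' t = front_speed (1/2 * (y1 (li t - t) - p (li t - t))\<^sup>2) (\<kappa> (li t))"
    using init by (auto simp: initial_branch_def li'_def p_def)
  note li_deriv = C1_on_interval[OF li(1) ts, folded li'_def]
  have tb: "0 < tb" "tb < T" and L: "C1_on {tb..T} L" "L T = lb0" "tb + L tb = T"
    using fin by (auto simp: final_branch_def)
  note L_deriv = C1_on_interval[OF L(1) tb(2), folded L'_def]
  \<comment> \<open>The point reached at time T by the incoming characteristic that leaves the front
    at t.\<close>
  define x where "x t = t + L t - T" for t
  have L'_cases: "L' t \<in> {0..<1}" "(yb1 (x t) + pb (x t))\<^sup>2 \<le> 2 * \<kappa> (L t)"
    "L' t = 0 \<or> L' t = (2 * \<kappa> (L t) - (yb1 (x t) + pb (x t))\<^sup>2) / (2 * \<kappa> (L t) + (yb1 (x t) + pb (x t))\<^sup>2)"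
    if "t \<in> {tb..T}" for t
  proof -
    have "\<forall>t\<in>{tb..T}. let x = t + L t - T; Y = \<bar>yb1 x + pb x\<bar>\<^sup>2; k = \<kappa> (L t) in
        Y \<le> 2 * k \<and> L' t \<in> {0, (2 * k - Y) / (2 * k + Y)} \<inter> {0..<1}"
      using fin unfolding final_branch_def L'_def pb_def by blast
    from bspec[OF this that] show "L' t \<in> {0..<1}" "(yb1 (x t) + pb (x t))\<^sup>2 \<le> 2 * \<kappa> (L t)"
      "L' t = 0 \<or> L' t = (2 * \<kappa> (L t) - (yb1 (x t) + pb (x t))\<^sup>2) / (2 * \<kappa> (L t) + (yb1 (x t) + pb (x t))\<^sup>2)"
      by (auto simp: Let_def x_def)
  qed

  have li_ge: "l0 \<le> li t" if "t \<in> {0..ts}" for t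
    using mono_if_deriv_nonneg[OF li_deriv(1), of 0 t] li'_eq that li(2) by (auto simp: front_speed_def)
  interpret i: front ts l0 li li'
  proof
    show "li' t \<in> {0..<1}" if "t \<in> {0..ts}" for t
      unfolding li'_eq[OF that]
      using toughness_bounds(3)[OF \<kappa>, of "li t"] li_ge[OF that] l0 by (intro front_speed_range) auto
  qed (use ts l0 li li_deriv in auto)
  have L_ge: "T - tb \<le> L t" if "t \<in> {tb..T}" for t
    using mono_if_deriv_nonneg[OF L_deriv(1), of tb t] L'_cases(1) that L(3) by auto
  have x_deriv: "(x has_real_derivative 1 + L' t) (at t within {tb..T})" if "t \<in> {tb..T}" for t
    unfolding x_def using L_deriv(1)[OF that] by (auto intro!: derivative_eq_intros)
  have x_range: "x t \<in> {0..lb0}" if "t \<in> {tb..T}" for t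
    using mono_if_deriv_nonneg[OF x_deriv, of tb t] mono_if_deriv_nonneg[OF x_deriv, of t T]
      L'_cases(1) that L by (force simp: x_def)
  have lb0: "0 < lb0" using L_ge[of T] L(2) tb by auto

  \<comment> \<open>D is the distance to cover between ts and tb. \<open>L tb < tb\<close> makes the
    mean speed less than 1, and \<open>sep\<close> gives D > 0 when an end speed is
    positive.\<close>
  define a b D where "a = li' ts" and "b = L' tb" and "D = L tb - ts"
  have ab: "a \<in> {0..<1}" "b \<in> {0..<1}"
    using i.v_range[of ts] L'_cases(1)[of tb] ts tb by (auto simp: a_def b_def)
  have tstb: "ts \<le> L tb" "ts < tb" and D: "0 \<le> D" "D < tb - ts" "0 < a \<or> 0 < b \<Longrightarrow> 0 < D"
    using sep Ltb li(3) by (auto simp: D_def a_def b_def li'_def L'_def split: if_splits)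
  define \<psi>i where "\<psi>i t = (y1 (li t - t) - p (li t - t)) / 2" for t
  \<comment> \<open>The reflection law (1 - v) f' = (1 + v) g' solved for f', with g' dictated by
    the final state.\<close>
  define \<psi>f where "\<psi>f t = - ((1 + L' t) / (1 - L' t) * (yb1 (x t) + pb (x t)) / 2)" for t
  have \<psi>i_speed: "front_speed (2 * (\<psi>i t)\<^sup>2) (\<kappa> (li t)) = li' t" if "t \<in> {0..ts}" for t
    using li'_eq[OF that] by (simp add: \<psi>i_def power_divide)
  have \<psi>f_speed: "front_speed (2 * (\<psi>f t)\<^sup>2) (\<kappa> (L t)) = L' t" if t: "t \<in> {tb..T}" for t
  proof -
    have k: "0 < \<kappa> (L t)" using toughness_bounds(3)[OF \<kappa>, of "L t"] L_ge[OF t] tb by auto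
    define Y where "Y = (yb1 (x t) + pb (x t))\<^sup>2"
    have Y: "0 \<le> Y" "Y \<le> 2 * \<kappa> (L t)" using L'_cases(2)[OF t] by (auto simp: Y_def)
    have sq: "2 * (\<psi>f t)\<^sup>2 = ((1 + L' t) / (1 - L' t))\<^sup>2 * Y / 2"
    proof -
      have "2 * (- (z * s / 2))\<^sup>2 = z\<^sup>2 * s\<^sup>2 / 2" for z s :: real
        by (simp add: power_mult_distrib power_divide)
      then show ?thesis unfolding \<psi>f_def Y_def .
    qed
    consider "L' t = 0" | "L' t = (2 * \<kappa> (L t) - Y) / (2 * \<kappa> (L t) + Y)"
      using L'_cases(3)[OF t] by (auto simp: Y_def)
    then show ?thesis
    proof cases
      case 1
      have "(Y / 2 - \<kappa> (L t)) / (Y / 2 + \<kappa> (L t)) \<le> 0"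
        using Y k by (intro divide_nonpos_pos) auto
      then show ?thesis unfolding sq using 1 by (simp add: front_speed_def)
    next
      case 2
      \<comment> \<open>Y = 0 would give speed 1.\<close>
      have "Y \<noteq> 0" using 2 k L'_cases(1)[OF t] by auto
      then have Y0: "0 < Y" using Y by simp
      have ratio: "(1 + L' t) / (1 - L' t) = 2 * \<kappa> (L t) / Y"
        unfolding 2 using Y0 k by (simp add: divide_simps)
      have q: "2 * (\<psi>f t)\<^sup>2 = 2 * (\<kappa> (L t))\<^sup>2 / Y"
        unfolding sq ratio using Y0 by (simp add: power2_eq_square divide_simps)
      have "(2 * (\<kappa> (L t))\<^sup>2 / Y - \<kappa> (L t)) / (2 * (\<kappa> (L t))\<^sup>2 / Y + \<kappa> (L t)) = L' t"
      proof -
        have "2 * (\<kappa> (L t))\<^sup>2 / Y - \<kappa> (L t) = \<kappa> (L t) / Y * (2 * \<kappa> (L t) - Y)"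
          "2 * (\<kappa> (L t))\<^sup>2 / Y + \<kappa> (L t) = \<kappa> (L t) / Y * (2 * \<kappa> (L t) + Y)"
          using Y0 by (simp_all add: field_simps power2_eq_square)
        then show ?thesis unfolding 2 using Y0 k by simp
      qed
      then show ?thesis unfolding q front_speed_def using L'_cases(1)[OF t] by simp
    qed
  qed

  have k: "0 < \<kappa> ts" "0 < \<kappa> (L tb)"
    using toughness_bounds(3)[OF \<kappa>] ts tstb by auto
  \<comment> \<open>After division by the amplitude, Griffith's criterion no longer mentions the
    toughness, so the speed profile can be chosen before the position of the front is known.\<close>
  define wa wb where "wa = \<psi>i ts / amplitude a (\<kappa> ts)" and "wb = \<psi>f tb / amplitude b (\<kappa> (L tb))"
  have amp: "0 < amplitude a (\<kappa> ts)" "0 < amplitude b (\<kappa> (L tb))"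
    using ab k by (auto intro: amplitude_pos)
  have w: "\<bar>wa\<bar> \<le> 1" "\<bar>wb\<bar> \<le> 1" "0 < a \<Longrightarrow> \<bar>wa\<bar> = 1" "0 < b \<Longrightarrow> \<bar>wb\<bar> = 1"
    using front_speed_eq_iff[OF ab(1) k(1), of "\<psi>i ts"] front_speed_eq_iff[OF ab(2) k(2), of "\<psi>f tb"]
      \<psi>i_speed[of ts] \<psi>f_speed[of tb] ts tb li(3) amp
    by (auto simp: wa_def wb_def a_def b_def)
  obtain vm wm where m_cont: "continuous_on {ts..tb} vm" "continuous_on {ts..tb} wm"
    and m_ends: "vm ts = a" "vm tb = b" "wm ts = wa" "wm tb = wb"
    and m: "\<And>t. t \<in> {ts..tb} \<Longrightarrow> vm t \<in> {0..<1} \<and> \<bar>wm t\<bar> \<le> 1 \<and> (0 < vm t \<longrightarrow> \<bar>wm t\<bar> = 1)"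
    and m_int: "integral {ts..tb} vm = D"
    using connecting_profile[OF ab D w] by blast

  define v where "v t = (if t \<le> ts then li' t else if t \<le> tb then vm t else L' t)" for t
  have v_i: "v t = li' t" if "t \<in> {0..ts}" for t using that by (auto simp: v_def)
  have v_m: "v t = vm t" if "t \<in> {ts..tb}" for t
    using that m_ends by (cases "t = ts") (auto simp: v_def a_def)
  have v_f: "v t = L' t" if "t \<in> {tb..T}" for t
    using that m_ends tstb by (cases "t = tb") (auto simp: v_def b_def)
  have v_cont: "continuous_on {0..T} v"
    unfolding v_def using m_ends tstb
    by (intro continuous_on_glue li_deriv(2) L_deriv(2) m_cont) (auto simp: a_def b_def)
  define l where "l t = l0 + integral {0..t} v" for t
  have l_deriv: "(l has_real_derivative v t) (at t within {0..T})" if "t \<in> {0..T}" for t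
    unfolding l_def using DERIV_add[OF DERIV_const[of l0] integral_has_real_derivative[OF v_cont that]] by simp
  have l_i: "l t = li t" if "t \<in> {0..ts}" for t
  proof (rule eq_if_deriv_eq[of 0 ts l li' li 0 t])
    show "(l has_real_derivative li' t) (at t within {0..ts})" if "t \<in> {0..ts}" for t
      using has_field_derivative_subset[OF l_deriv, of t "{0..ts}"] that v_i[OF that] tstb tb by auto
  qed (use li_deriv(1) ts li that in \<open>auto simp: l_def\<close>)
  have l_tb: "l tb = L tb"
  proof -
    have "integral {0..tb} v = integral {0..ts} v + integral {ts..tb} v"
      using ts tstb tb
      by (intro Henstock_Kurzweil_Integration.integral_combine[symmetric]
          integrable_continuous_interval continuous_on_subset[OF v_cont]) auto
    also have "integral {ts..tb} v = D"
      using m_int integral_cong[of "{ts..tb}" v vm] v_m by simp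
    finally show ?thesis using l_i[of ts] ts li by (simp add: l_def D_def)
  qed
  have l_f: "l t = L t" if "t \<in> {tb..T}" for t
  proof (rule eq_if_deriv_eq[of tb T l L' L tb t])
    show "(l has_real_derivative L' t) (at t within {tb..T})" if "t \<in> {tb..T}" for t
      using has_field_derivative_subset[OF l_deriv, of t "{tb..T}"] that v_f[OF that] tb by auto
  qed (use L_deriv(1) tb that l_tb in auto)
  interpret f: front T l0 l v
  proof
    show "v t \<in> {0..<1}" if "t \<in> {0..T}" for t
    proof -
      consider "t \<in> {0..ts}" | "t \<in> {ts..tb}" | "t \<in> {tb..T}" using \<open>t \<in> {0..T}\<close> by fastforce
      then show ?thesis
        by cases (use v_i v_m v_f i.v_range m L'_cases(1) in \<open>simp_all del: atLeastLessThan_iff\<close>)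
    qed
  qed (use tb l0 l_deriv v_cont in \<open>auto simp: l_def\<close>)

  \<comment> \<open>Undoes the normalisation, now that the position l t is available.\<close>
  define \<psi>m where "\<psi>m t = wm t * amplitude (vm t) (\<kappa> (l t))" for t
  define \<psi> where "\<psi> t = (if t \<le> ts then \<psi>i t else if t \<le> tb then \<psi>m t else \<psi>f t)" for t
  have ends: "\<psi>i ts = \<psi>m ts" "\<psi>m tb = \<psi>f tb"
    using m_ends amp l_i[of ts] l_tb li(3) ts by (simp_all add: \<psi>m_def wa_def wb_def)
  have \<psi>_m: "\<psi> t = \<psi>m t" if "t \<in> {ts..tb}" for t
    using that ends by (cases "t = ts") (auto simp: \<psi>_def)
  have \<psi>_f: "\<psi> t = \<psi>f t" if "t \<in> {tb..T}" for t
    using that ends tstb by (cases "t = tb") (auto simp: \<psi>_def)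
  have \<kappa>_pos: "0 < \<kappa> (l t)" if "t \<in> {0..T}" for t
    using toughness_bounds(3)[OF \<kappa>] f.l_pos[OF that] by auto
  have \<psi>_cont: "continuous_on {0..T} \<psi>"
    unfolding \<psi>_def
  proof (intro continuous_on_glue)
    have r: "li t - t \<in> {0..l0}" if "t \<in> {0..ts}" for t
      using i.minus_range[OF that] li(3) by auto
    show "continuous_on {0..ts} \<psi>i"
      unfolding \<psi>i_def p_def
      by (intro continuous_intros continuous_on_compose2[OF y1] continuous_on_compose2[OF C1_on_interval(2)[OF y0 l0]]
          i.l_cont) (use r in \<open>auto simp del: atLeastAtMost_iff\<close>)
    have "continuous_on {0..} \<kappa>"
      using local_lipschitz_continuous_on[of UNIV "{0..}" "\<lambda>_ :: real. \<kappa>" 0] \<kappa> by (simp add: toughness_def)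
    then have "continuous_on {ts..tb} (\<lambda>t. \<kappa> (l t))"
      by (rule continuous_on_compose2)
        (use ts tb f.l_pos in \<open>force intro: continuous_on_subset[OF f.l_cont] less_imp_le\<close>)+
    moreover have "2 * (1 - vm t) \<noteq> 0" if "t \<in> {ts..tb}" for t using m[OF that] by auto
    ultimately show "continuous_on {ts..tb} \<psi>m"
      unfolding \<psi>m_def amplitude_def by (intro continuous_intros m_cont) auto
    have x_cont: "continuous_on {tb..T} x"
      unfolding continuous_on_eq_continuous_within using DERIV_continuous[OF x_deriv] by blast
    have "1 - L' t \<noteq> 0" if "t \<in> {tb..T}" for t using L'_cases(1)[OF that] by auto
    moreover have "x ` {tb..T} \<subseteq> {0..lb0}" using x_range by blast
    ultimately show "continuous_on {tb..T} \<psi>f"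
      unfolding \<psi>f_def pb_def
      by (intro continuous_intros continuous_on_compose2[OF yb1 x_cont]
          continuous_on_compose2[OF C1_on_interval(2)[OF yb0 lb0] x_cont] L_deriv(2)) auto
  qed (use ends tstb in auto)
  have speed: "v t = front_speed (2 * (\<psi> t)\<^sup>2) (\<kappa> (l t))" if t: "t \<in> {0..T}" for t
  proof -
    consider "t \<in> {0..ts}" | "t \<in> {ts..tb}" | "t \<in> {tb..T}" using t by fastforce
    then show ?thesis
    proof cases
      case 1
      then show ?thesis using \<psi>i_speed[OF 1] l_i[OF 1] v_i[OF 1] by (simp add: \<psi>_def)
    next
      case 2
      have "0 < amplitude (vm t) (\<kappa> (l t))"
        using m[OF 2] \<kappa>_pos[OF t] by (intro amplitude_pos) auto
      then have "front_speed (2 * (\<psi>m t)\<^sup>2) (\<kappa> (l t)) = vm t"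
        using m[OF 2] \<kappa>_pos[OF t] by (subst front_speed_eq_iff) (auto simp: \<psi>m_def abs_mult)
      then show ?thesis using v_m[OF 2] \<psi>_m[OF 2] by simp
    next
      case 3
      then show ?thesis using \<psi>f_speed[OF 3] l_f[OF 3] v_f[OF 3] \<psi>_f[OF 3] by simp
    qed
  qed
  show thesis
  proof (rule that[OF f.front_axioms \<psi>_cont speed])
    show "ts \<in> {0..T}" "l ts = ts" using ts tstb tb l_i[of ts] li(3) by auto
    show "\<psi> t = (y1 (l t - t) - p (l t - t)) / 2" if "t \<in> {0..ts}" for t
      using that l_i[OF that] by (simp add: \<psi>_def \<psi>i_def)
    fix t assume t: "t \<in> {tb..T}"
    show "l t = L t \<and> v t = deriv_on {tb..T} L t" using l_f[OF t] v_f[OF t] by (simp add: L'_def)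
    have "(1 - w) * - ((1 + w) / (1 - w) * s / 2) = - (1 + w) * s / 2" if "w < 1" for w s :: real
    proof -
      have z: "(1 - w) * ((1 + w) / (1 - w)) = 1 + w" using that by simp
      have "(1 - w) * - (z * s / 2) = - ((1 - w) * z) * s / 2" for z by simp
      from this[of "(1 + w) / (1 - w)"] show ?thesis unfolding z .
    qed
    moreover have "L' t < 1" using L'_cases(1)[OF t] by simp
    ultimately show "(1 - v t) * \<psi> t = - (1 + v t) * (yb1 (t + l t - T) + pb (t + l t - T)) / 2"
      unfolding \<psi>_f[OF t] v_f[OF t] \<psi>f_def x_def l_f[OF t] by blast
  qed
qed

section \<open>The control and the final state of every solution\<close>

theorem theorem4p8:
  fixes c1 c2 l0 T lb0 \<alpha> tb ts :: real
    and \<kappa> y0 y1 yb0 yb1 li L :: "real \<Rightarrow> real"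
  assumes "toughness c1 c2 \<kappa>"
    and "0 < l0"
    and "C1_on {0..l0} y0" and "continuous_on {0..l0} y1"
    and "y0 l0 = 0"
    and "y1 l0 = - front_speed (1/2 * (y1 l0 - deriv_on {0..l0} y0 l0)\<^sup>2) (\<kappa> l0)
                   * deriv_on {0..l0} y0 l0"
    and "l0 < T"
    and "final_data \<kappa> l0 lb0 yb0 yb1 \<alpha>"
    and "final_branch \<kappa> T lb0 yb0 yb1 \<alpha> tb L"
    and "initial_branch \<kappa> l0 y0 y1 ts li"
    and "if deriv_on {0..ts} li ts = 0 \<and> deriv_on {tb..T} L tb = 0
         then li ts \<le> L tb else li ts < L tb"
    and "L tb < tb"
  shows "\<exists>u. C1_on {0..T} u \<and>
           (\<exists>l y. C1_solution \<kappa> l0 y0 y1 T u l y) \<and>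
           (\<forall>l y. C1_solution \<kappa> l0 y0 y1 T u l y \<longrightarrow>
              l T = lb0 \<and>
              (\<forall>x\<in>{0..lb0}. y T x = yb0 x \<and> partial_t (region T l) y T x = yb1 x))"
proof -
  define p pb where "p = deriv_on {0..l0} y0" and "pb = deriv_on {0..lb0} yb0"
  have yb0: "C1_on {0..lb0} yb0" "yb0 lb0 = 0" and yb1: "continuous_on {0..lb0} yb1"
    and lb0: "l0 \<le> lb0" "0 < lb0" and end_speed: "yb1 lb0 = - \<alpha> * pb lb0" "\<alpha> \<in> {0..<1}"
    using assms(2,8) by (auto simp: final_data_def Let_def pb_def)
  have L: "L T = lb0" "tb \<in> {0..T}" "tb + L tb = T" "deriv_on {tb..T} L T = \<alpha>"
    using assms(9) by (auto simp: final_branch_def)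
  from matching_front[OF assms(1-4) yb0(1) yb1 assms(9-12)]
  obtain l v \<psi> where F: "front T l0 l v" and \<psi>: "continuous_on {0..T} \<psi>"
    and speed: "\<And>t. t \<in> {0..T} \<Longrightarrow> v t = front_speed (2 * (\<psi> t)\<^sup>2) (\<kappa> (l t))"
    and ts: "ts \<in> {0..T}" "l ts = ts"
    and \<psi>_i: "\<And>t. t \<in> {0..ts} \<Longrightarrow> \<psi> t = (y1 (l t - t) - p (l t - t)) / 2"
    and lL: "\<And>t. t \<in> {tb..T} \<Longrightarrow> l t = L t \<and> v t = deriv_on {tb..T} L t"
    and \<psi>_f: "\<And>t. t \<in> {tb..T} \<Longrightarrow>
      (1 - v t) * \<psi> t = - (1 + v t) * (yb1 (t + l t - T) + pb (t + l t - T)) / 2"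
    unfolding p_def pb_def by blast
  interpret front T l0 l v by (rule F)
  have lT: "l T = lb0" "v T = \<alpha>" using lL[of T] L by auto
  \<comment> \<open>Characteristics with s \<le> T - lb0 have met the front by time T and take their
    slope from there; for the later ones it is read off the final state.\<close>
  define \<phi> where "\<phi> s = (if s \<le> T - lb0 then \<psi> (arrival s) else (yb1 (T - s) - pb (T - s)) / 2)" for s
  have arrival_end: "arrival (T - lb0) = T" using arrival_minus[of T] lT T_pos by simp
  \<comment> \<open>By yb1 lb0 = - \<alpha> * pb lb0 both formulas give - (1 + \<alpha>) * pb lb0 /
    2, so the pieces of \<phi> fit together.\<close>
  have \<psi>_end: "\<psi> T = (yb1 lb0 - pb lb0) / 2"
  proof -
    have "(1 - \<alpha>) * \<psi> T = (1 - \<alpha>) * ((yb1 lb0 - pb lb0) / 2)"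
      using \<psi>_f[of T] L lT end_speed(1) by (simp add: field_simps)
    then show ?thesis using end_speed(2) by simp
  qed
  have \<phi>_cont: "continuous_on {- l0..T} \<phi>"
    unfolding \<phi>_def
  proof (rule continuous_on_glue)
    show "continuous_on {- l0..T - lb0} (\<lambda>s. \<psi> (arrival s))"
      using arrival arrival_cont lT by (intro continuous_on_compose2[OF \<psi>]) auto
    show "continuous_on {T - lb0..T} (\<lambda>s. (yb1 (T - s) - pb (T - s)) / 2)"
      unfolding pb_def
      by (intro continuous_intros continuous_on_compose2[OF yb1]
          continuous_on_compose2[OF C1_on_interval(2)[OF yb0(1) lb0(2)]]) auto
  qed (simp add: arrival_end \<psi>_end)
  have \<phi>_front: "\<phi> (t - l t) = \<psi> t" if "t \<in> {0..T}" for t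
    using minus_range[OF that] arrival_minus[OF that] lT by (simp add: \<phi>_def)
  have \<phi>_init: "\<phi> s = (y1 (- s) - p (- s)) / 2" if "s \<in> {- l0..0}" for s
  proof -
    have s: "s \<in> {- l0..T - l T}" using that minus_range[OF ts(1)] ts(2) by auto
    define t where "t = arrival s"
    have t: "t \<in> {0..T}" "t - l t = s" using arrival[OF s] by (auto simp: t_def)
    \<comment> \<open>Because t - l t = s \<le> 0 = ts - l ts.\<close>
    have "t \<le> ts"
      using strict_mono_onD[OF minus_mono, of ts t] t ts that by force
    then show ?thesis using \<phi>_front[OF t(1)] \<psi>_i[of t] t by auto
  qed
  have \<phi>_end: "\<phi> (T - x) = (yb1 x - pb x) / 2" if "x \<in> {0..lb0}" for x
    using that \<psi>_end arrival_end by (cases "x = lb0") (auto simp: \<phi>_def)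
  have "v 0 = front_speed (1/2 * (y1 l0 - p l0)\<^sup>2) (\<kappa> l0)"
    using speed[of 0] \<phi>_front[of 0] \<phi>_init[of "- l0"] T_pos l0_pos l_0 by (simp add: power_divide)
  then have compat: "y1 l0 = - v 0 * deriv_on {0..l0} y0 l0" using assms(6) by (simp add: p_def)
  have \<phi>_speed: "v t = front_speed (2 * (\<phi> (t - l t))\<^sup>2) (\<kappa> (l t))" if "t \<in> {0..T}" for t
    using speed[OF that] \<phi>_front[OF that] by simp
  obtain u f where u: "C1_on {0..T} u"
    and f: "\<And>s. s \<in> {- l0..T} \<Longrightarrow> (f has_real_derivative \<phi> s) (at s within {- l0..T})"
    and sol: "C1_solution \<kappa> l0 y0 y1 T u l (\<lambda>t x. f (t - x) - incoming_wave l0 y0 y1 T u l f (t + x))"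
    using C1_solution_exists[OF assms(7,3,4) compat \<phi>_cont \<phi>_init[unfolded p_def] \<phi>_speed] by blast
  show ?thesis
  proof (rule exI[of _ u], intro conjI allI impI ballI)
    show "C1_on {0..T} u" by (rule u)
    show "\<exists>l y. C1_solution \<kappa> l0 y0 y1 T u l y" using sol by blast
    \<comment> \<open>By uniqueness an arbitrary solution for u has the constructed front and
      displacement, so \<open>terminal_state\<close> can be applied to y' itself.\<close>
    fix l' y' assume sol': "C1_solution \<kappa> l0 y0 y1 T u l' y'"
    note uniq = C1_solution_unique[OF assms(1,2) T_pos sol sol']
    have R: "region T l' = region T l" using uniq(1) by (auto simp: region_def)
    show "l' T = lb0" using uniq(1)[of T] T_pos lT by simp
    fix x assume x: "x \<in> {0..lb0}"
    have y'_C1: "C1_on (region T l) (case_prod y')" using sol' R by (simp add: C1_solution_def)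
    have tb: "tb + l tb = T" using lL[of tb] L by auto
    have \<phi>_f: "(1 - v t) * \<phi> (t - l t) = - (1 + v t) * (yb1 (t + l t - T) + pb (t + l t - T)) / 2"
      if "t \<in> {tb..T}" for t
      using \<psi>_f[OF that] \<phi>_front[of t] that L by simp
    have "y' T x = yb0 x \<and> partial_t (region T l) y' T x = yb1 x"
      using terminal_state[where ?yb0.0 = yb0 and ?yb1.0 = yb1 and y = y' and x = x and tb = tb, unfolded lT,
          OF assms(7) f yb0 L(2) tb \<phi>_end[unfolded pb_def] \<phi>_f[unfolded pb_def] uniq(2) y'_C1 x]
      by blast
    then show "y' T x = yb0 x" "partial_t (region T l') y' T x = yb1 x" using R by simp_all
  qed
qed

end
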